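(* Let $N,N'$ be integers with $2\le N'\le N-2$. Among lower triangular $H\in\mathbb{R}^{(N-1)\times(N-1)}$ with nonzero diagonal entries, the unique set of values of the Q-functions $Q(N-1,k,j)$ ($j=1,\dots,N-1$, $k=1,\dots,N-j$) satisfying - $\lambda^\star_{j+1,j}=\lambda^\star_{j+2,j}=\cdots=\lambda^\star_{N-1,j}=0$ for $j=1,\dots,N'-1$, - $\lambda^\star_{j+2,j}=\lambda^\star_{j+3,j}=\cdots=\lambda^\star_{N,j}=0$ for $j=N',\dots,N-1$ (vacuous for $j=N-1$), and - the H-invariance condition $\sum_{j=1}^{N-m}Q(N-1,m,j)=\frac1N\binom{N}{m+1}$ for $m=1,\dots,N-1$, is given by $$Q(N-1,k,j)=\begin{cases}\frac1{k+1}\binom{N-j-1}{k-1} & \text{for } j=1,\dots,N'-1,\\[1mm] \frac{j-N'+1}{N-N'+1}\binom{N-j-1}{k-1} & \text{for } j=N',\dots,N-1,\end{cases}\qquad k=1,\dots,N-j.$$ With these Q-functions, $\lambda^\star_{N,j}>0$ for $j=1,\dots,N'-1$ and $\lambda^\star_{j+1,j}>0$ for $j=N',\dots,N-1$, so the corresponding $H$ represents a minimax optimal algorithm.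
   Context: For a lower triangular $H=(h_{i,j})\in\mathbb{R}^{(N-1)\times(N-1)}$ (dependence on $H$ suppressed), define for $m,j\in\{1,\dots,N-1\}$ $$Q(N-1,m,j)=\sum_{j=j(1)\le i(1)<j(2)\le i(2)<\cdots<j(m)\le i(m)\le N-1}\ \prod_{r=1}^m h_{i(r),j(r)}$$ (empty sums are $0$). The H-certificates $\lambda^\star_{k,j}$, $1\le j<k\le N$, are $$\lambda^\star_{N,j}=N\sum_{m=1}^{N-j}(-1)^{m-1}Q(N-1,m,j),\qquad j=1,\dots,N-1,$$ $$\lambda^\star_{k,j}=N\sum_{\ell=1}^{N-j}\sum_{m=1}^{N-k}(-1)^{\ell+m-1}\binom{\ell+m}{m}Q(N-1,\ell,j)\,Q(N-1,m,k),\qquad 1\le j<k\le N-1.$$ The map sending a lower triangular $H$ with nonzero diagonal entries to the family $(Q(N-1,k,j))_{1\le j\le N-1,\,1\le k\le N-j}$ is a one-to-one correspondence onto the families with $Q(N-1,N-j,j)\ne0$ for all $j$; "the corresponding $H$" refers to this correspondence. $H$ represents a minimax optimal algorithm if, for every $d\ge1$, every nonexpansive (1-Lipschitz) $T:\mathbb{R}^d\to\mathbb{R}^d$ with a fixed point $y_\star$ and every $y_0\in\mathbb{R}^d$, the iterates $y_{k+1}=y_k-\sum_{j=0}^kh_{k+1,j+1}(y_j-Ty_j)$, $k=0,\dots,N-2$, satisfy $\|y_{N-1}-Ty_{N-1}\|^2\le\frac{4\|y_0-y_\star\|^2}{N^2}$. *)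

theory Defs
  imports "HOL-Analysis.Analysis"
begin

text \<open>
  A real \<open>n \<times> n\<close> matrix is represented by a function on pairs of 1-based indices which vanishes
  outside \<open>{1..n} \<times> {1..n}\<close>. Since a lower triangular matrix also vanishes for \<open>i < j\<close>, the
  set below is in bijection with the lower triangular matrices with nonzero diagonal entries, and
  equality of its members is equality of matrices.
\<close>

definition lower_tri_nz :: "nat \<Rightarrow> (nat \<Rightarrow> nat \<Rightarrow> real) set" where
  "lower_tri_nz n =
     {H. (\<forall>i j. \<not> (1 \<le> j \<and> j \<le> i \<and> i \<le> n) \<longrightarrow> H i j = 0) \<and> (\<forall>i\<in>{1..n}. H i i \<noteq> 0)}"

text \<open>
  The index tuples \<open>j = b 1 \<le> a 1 < b 2 \<le> a 2 < \<dots> < b m \<le> a m \<le> n\<close>, where \<open>a r\<close> plays the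
  role of \<open>i(r)\<close> and \<open>b r\<close> that of \<open>j(r)\<close>. They are extensional functions, so that each tuple
  is counted once. Only \<open>m \<ge> 1\<close> is meaningful.
\<close>

definition Q_indices :: "nat \<Rightarrow> nat \<Rightarrow> nat \<Rightarrow> ((nat \<Rightarrow> nat) \<times> (nat \<Rightarrow> nat)) set" where
  "Q_indices n m j =
     {(a, b). a \<in> {1..m} \<rightarrow>\<^sub>E {1..n} \<and> b \<in> {1..m} \<rightarrow>\<^sub>E {1..n} \<and> b 1 = j \<and>
        (\<forall>r\<in>{1..m}. b r \<le> a r) \<and> (\<forall>r\<in>{1..<m}. a r < b (r + 1))}"

definition Q :: "(nat \<Rightarrow> nat \<Rightarrow> real) \<Rightarrow> nat \<Rightarrow> nat \<Rightarrow> nat \<Rightarrow> real" where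
  "Q H n m j = (\<Sum>(a, b)\<in>Q_indices n m j. \<Prod>r=1..m. H (a r) (b r))"

definition H_cert :: "nat \<Rightarrow> (nat \<Rightarrow> nat \<Rightarrow> real) \<Rightarrow> nat \<Rightarrow> nat \<Rightarrow> real" where
  "H_cert N H k j =
     (if k = N
      then real N * (\<Sum>m=1..N-j. (-1) ^ (m - 1) * Q H (N - 1) m j)
      else real N * (\<Sum>l=1..N-j. \<Sum>m=1..N-k.
             (-1) ^ (l + m - 1) * real ((l + m) choose m) * Q H (N - 1) l j * Q H (N - 1) m k))"

definition H_invariant :: "nat \<Rightarrow> (nat \<Rightarrow> nat \<Rightarrow> real) \<Rightarrow> bool" where
  "H_invariant N H \<longleftrightarrow>
     (\<forall>m\<in>{1..N-1}. (\<Sum>j=1..N-m. Q H (N - 1) m j) = 1 / real N * real (N choose (m + 1)))"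

text \<open>
  A formula cannot quantify over types, so the dimension \<open>d = CARD('n)\<close> is a parameter; the
  quantification over all \<open>d \<ge> 1\<close> is recovered by stating the property for an arbitrary finite
  type \<open>'n\<close>.
\<close>

definition minimax_optimal ::
    "'n::finite itself \<Rightarrow> nat \<Rightarrow> (nat \<Rightarrow> nat \<Rightarrow> real) \<Rightarrow> bool" where
  "minimax_optimal _ N H \<longleftrightarrow>
     (\<forall>(T :: real ^ 'n \<Rightarrow> real ^ 'n) ystar y.
        1-lipschitz_on UNIV T \<and> T ystar = ystar \<and>
        (\<forall>k<N - 1. y (k + 1) = y k - (\<Sum>j=0..k. H (k + 1) (j + 1) *\<^sub>R (y j - T (y j))))
        \<longrightarrow> (norm (y (N - 1) - T (y (N - 1))))\<^sup>2 \<le> 4 * (norm (y 0 - ystar))\<^sup>2 / (real N)\<^sup>2)"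

definition Q_value :: "nat \<Rightarrow> nat \<Rightarrow> nat \<Rightarrow> nat \<Rightarrow> real" where
  "Q_value N N' k j =
     (if j < N'
      then 1 / (real k + 1) * real ((N - j - 1) choose (k - 1))
      else (real j - real N' + 1) / (real N - real N' + 1) * real ((N - j - 1) choose (k - 1)))"

end

theory Submission
  imports Defs
begin

text \<open>
  Splitting the first index off the tuples in \<open>Q\<close> gives
  \<open>Q(n, m + 1, j) = (\<Sum>i\<ge>j. h\<^sub>i\<^sub>j \<Sum>b>i. Q(n, m, b))\<close>, which for each column \<open>j\<close> is a triangular
  system with nonzero diagonal, so the Q-functions determine \<open>H\<close>.

  The certificate \<open>\<lambda>\<^sub>k\<^sub>j\<close> is a combination, with coefficients \<open>Q(N - 1, m, k)\<close>, of the moments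
  \<open>\<Sum>l. (-1)\<^sup>l (l + m choose m) Q(N - 1, l, j)\<close>. Since \<open>Q(N - 1, N - k, k) \<noteq> 0\<close>, vanishing of the
  certificates of column \<open>j\<close> means vanishing of the moments of order \<open>1, \<dots>, N - j - 1\<close> for
  \<open>j < N'\<close> and of order \<open>0, \<dots>, N - j - 2\<close> for \<open>j \<ge> N'\<close>. This determines the column up to a
  scalar, and H-invariance, read from \<open>m = N - 1\<close> downwards, fixes the scalars one at a time.

  The matrix with the prescribed Q-functions is explicit: its columns \<open>j \<ge> N'\<close> are those of the
  optimal Halpern method of size \<open>N - N' + 1\<close>, its upper left block is that of the dual Halpern
  method of size \<open>N\<close>, and its lower left entries do not depend on the row. For its iterates the sum
  of the cocoercivity inequalities between \<open>x\<^sub>j\<close> and \<open>x\<^sub>N\<close> for \<open>j < N'\<close> and between \<open>x\<^sub>j\<close> and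
  \<open>x\<^sub>j\<^sub>+\<^sub>1\<close> for \<open>j \<ge> N'\<close>, weighted by the certificates, collapses to
  \<open>\<langle>g\<^sub>N, x\<^sub>1 - x\<^sub>N\<rangle> \<ge> (N - 1)/2 \<parallel>g\<^sub>N\<parallel>\<^sup>2\<close> with \<open>g\<^sub>N = x\<^sub>N - T x\<^sub>N\<close>.
\<close>

section \<open>The Q-functions of a triangular matrix\<close>

text \<open>The value \<open>1\<close> at \<open>m = 0\<close> lets the recursion for \<open>Q\<close> start at \<open>m = 0\<close>.\<close>

definition Q_tail :: "(nat \<Rightarrow> nat \<Rightarrow> real) \<Rightarrow> nat \<Rightarrow> nat \<Rightarrow> nat \<Rightarrow> real" where
  "Q_tail H n m s = (if m = 0 then 1 else (\<Sum>b=s..n. Q H n m b))"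

lemma finite_Q_indices: "finite (Q_indices n m j)"
proof -
  have "Q_indices n m j \<subseteq> ({1..m} \<rightarrow>\<^sub>E {1..n}) \<times> ({1..m} \<rightarrow>\<^sub>E {1..n})"
    by (auto simp: Q_indices_def)
  moreover have "finite (({1..m} \<rightarrow>\<^sub>E {1..n}) \<times> ({1..m} \<rightarrow>\<^sub>E {1..n}))"
    by (intro finite_cartesian_product finite_PiE) auto
  ultimately show ?thesis by (rule finite_subset)
qed

lemma Q_one:
  assumes "1 \<le> j"
  shows "Q H n 1 j = (\<Sum>i=j..n. H i j)"
  unfolding Q_def
  by (rule sum.reindex_bij_witness[where j = "\<lambda>(a, b). a 1"
        and i = "\<lambda>i. (\<lambda>r\<in>{1..1}. i, \<lambda>r\<in>{1..1}. j)"])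
    (use assms in \<open>auto simp: Q_indices_def PiE_iff extensional_def fun_eq_iff\<close>)

text \<open>Deleting the first pair \<open>(a 1, b 1)\<close> leaves a tuple that starts in some
  column \<open>b 2 > a 1\<close>, so sorting by \<open>i = a 1\<close> and \<open>b = b 2\<close>
  splits the index set into shorter ones.\<close>

lemma Q_Suc_Suc:
  assumes "1 \<le> j"
  shows "Q H n (Suc (Suc m)) j = (\<Sum>i=j..n. H i j * (\<Sum>b=Suc i..n. Q H n (Suc m) b))"
proof -
  let ?F = "\<lambda>(a, b). \<Prod>r=1..Suc m. H (a r) (b r)"
  let ?dec = "\<lambda>a::nat \<Rightarrow> nat. \<lambda>r\<in>{1..Suc m}. a (Suc r)"
  let ?con = "\<lambda>(x::nat) (a::nat \<Rightarrow> nat). \<lambda>r\<in>{1..Suc (Suc m)}. if r = 1 then x else a (r - 1)"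
  have "(\<Sum>i=j..n. H i j * (\<Sum>b=Suc i..n. Q H n (Suc m) b)) =
      (\<Sum>i=j..n. \<Sum>b=Suc i..n. \<Sum>p\<in>Q_indices n (Suc m) b. H i j * ?F p)"
    unfolding Q_def by (simp add: sum_distrib_left)
  also have "\<dots> = (\<Sum>i=j..n. \<Sum>(b, p)\<in>(SIGMA b:{Suc i..n}. Q_indices n (Suc m) b). H i j * ?F p)"
    by (intro sum.cong refl sum.Sigma) (auto simp: finite_Q_indices)
  also have "\<dots> = (\<Sum>(i, b, p)\<in>(SIGMA i:{j..n}. SIGMA b:{Suc i..n}. Q_indices n (Suc m) b).
      H i j * ?F p)"
    by (subst sum.Sigma) (auto simp: finite_Q_indices split_beta)
  also have "\<dots> = Q H n (Suc (Suc m)) j"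
    unfolding Q_def
  \<comment> \<open>\<open>?dec\<close> drops the first entry and shifts the others down;
    \<open>?con x\<close> puts \<open>x\<close> back in front. Both restrict to the exact domain, so
    they are mutually inverse on extensional functions.\<close>
  proof (rule sum.reindex_bij_witness[symmetric,
        where j = "\<lambda>(a, b). (a 1, b 2, ?dec a, ?dec b)"
          and i = "\<lambda>(i, b', a, b). (?con i a, ?con j b)"], goal_cases)
    case (1 p)
    obtain a b where p: "p = (a, b)" by fastforce
    have ext: "a \<in> extensional {1..Suc (Suc m)}" "b \<in> extensional {1..Suc (Suc m)}" "b 1 = j"
      using 1 by (auto simp: p Q_indices_def PiE_iff)
    have con_dec: "?con (a 1) (?dec a) = a" "?con j (?dec b) = b"
      using ext by (auto simp: fun_eq_iff extensional_def)
    show ?case unfolding p prod.case by (rule arg_cong2[where f = Pair, OF con_dec])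
  next
    case (2 p)
    obtain a b where p: "p = (a, b)" by fastforce
    have mem: "\<And>r. r \<in> {1..Suc (Suc m)} \<Longrightarrow> a r \<in> {1..n} \<and> b r \<in> {1..n} \<and> b r \<le> a r"
        "\<And>r. r \<in> {1..<Suc (Suc m)} \<Longrightarrow> a r < b (Suc r)" "b 1 = j"
      using 2 by (auto simp: p Q_indices_def PiE_iff)
    have "a 1 \<in> {j..n}" "b 2 \<in> {Suc (a 1)..n}"
      using mem(1)[of 1] mem(1)[of 2] mem(2)[of 1] mem(3) by (auto simp: numeral_2_eq_2)
    moreover have "(?dec a, ?dec b) \<in> Q_indices n (Suc m) (b 2)"
    proof -
      have "?dec a r \<in> {1..n} \<and> ?dec b r \<in> {1..n} \<and> ?dec b r \<le> ?dec a r"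
        if "r \<in> {1..Suc m}" for r
        using mem(1)[of "Suc r"] that by auto
      moreover have "?dec a r < ?dec b (r + 1)" if "r \<in> {1..<Suc m}" for r
        using mem(2)[of "Suc r"] that by auto
      moreover have "?dec b 1 = b 2" by (simp add: numeral_2_eq_2)
      ultimately show ?thesis
        unfolding Q_indices_def mem_Collect_eq prod.case PiE_iff by blast
    qed
    ultimately show ?case by (simp add: p)
  next
    case (3 q)
    obtain i b' a b where q: "q = (i, b', a, b)" by (metis prod.exhaust)
    have ext: "a \<in> extensional {1..Suc m}" "b \<in> extensional {1..Suc m}" "b 1 = b'"
      using 3 by (auto simp: q Q_indices_def PiE_iff)
    have "?dec (?con i a) = a" "?dec (?con j b) = b"
      using ext by (auto simp: fun_eq_iff extensional_def)
    then show ?case using ext by (simp add: q)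
  next
    case (4 q)
    obtain i b' a b where q: "q = (i, b', a, b)" by (metis prod.exhaust)
    have mem: "\<And>r. r \<in> {1..Suc m} \<Longrightarrow> a r \<in> {1..n} \<and> b r \<in> {1..n} \<and> b r \<le> a r"
        "\<And>r. r \<in> {1..<Suc m} \<Longrightarrow> a r < b (Suc r)" "b 1 = b'"
        "i \<in> {j..n}" "b' \<in> {Suc i..n}"
      using 4 by (auto simp: q Q_indices_def PiE_iff)
    have "?con i a r \<in> {1..n} \<and> ?con j b r \<in> {1..n} \<and> ?con j b r \<le> ?con i a r"
      if "r \<in> {1..Suc (Suc m)}" for r
    proof (cases r)
      case (Suc k)
      then show ?thesis using mem(1)[of k] mem(4) that assms by (cases k) auto
    qed (use that in simp)
    moreover have "?con i a r < ?con j b (r + 1)" if "r \<in> {1..<Suc (Suc m)}" for r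
    proof (cases r)
      case (Suc k)
      then show ?thesis using mem(2)[of k] mem(3-5) that by (cases k) auto
    qed (use that in simp)
    ultimately show ?case
      unfolding q Q_indices_def mem_Collect_eq prod.case PiE_iff by simp
  next
    case (5 p)
    obtain a b where p: "p = (a, b)" by fastforce
    have "b 1 = j" using 5 by (auto simp: p Q_indices_def)
    have "(\<Prod>r=1..Suc (Suc m). H (a r) (b r)) =
        H (a 1) (b 1) * (\<Prod>r=Suc 1..Suc (Suc m). H (a r) (b r))"
      by (rule prod.atLeast_Suc_atMost) simp
    also have "(\<Prod>r=Suc 1..Suc (Suc m). H (a r) (b r)) =
        (\<Prod>r=1..Suc m. H (a (Suc r)) (b (Suc r)))"
      by (rule prod.shift_bounds_cl_Suc_ivl)
    finally show ?case using \<open>b 1 = j\<close> by (simp add: p del: prod.cl_ivl_Suc)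
  qed
  finally show ?thesis ..
qed

lemma Q_Suc:
  assumes "1 \<le> j"
  shows "Q H n (Suc m) j = (\<Sum>i=j..n. H i j * Q_tail H n m (Suc i))"
proof (cases m)
  case 0
  then show ?thesis using Q_one[OF assms, of H n] by (simp add: Q_tail_def)
next
  case (Suc k)
  then show ?thesis by (simp add: Q_Suc_Suc[OF assms] Q_tail_def)
qed

text \<open>The \<open>m\<close> column indices increase strictly from \<open>j\<close> and stay at
  most \<open>n\<close>, so no tuple exists here. The recursion turns this into an induction on
  \<open>m\<close>.\<close>

lemma Q_eq_0:
  assumes "1 \<le> j" "n < m + j - 1" "1 \<le> m"
  shows "Q H n m j = 0"
  using assms
proof (induction m arbitrary: j)
  case (Suc m)
  have "Q_tail H n m (Suc i) = 0" if "i \<in> {j..n}" for i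
  proof -
    have "(\<Sum>b=Suc i..n. Q H n m b) = 0"
      by (intro sum.neutral ballI Suc.IH) (use that Suc.prems in auto)
    moreover have "m \<noteq> 0" using that Suc.prems by auto
    ultimately show ?thesis by (simp add: Q_tail_def)
  qed
  then have "(\<Sum>i=j..n. H i j * Q_tail H n m (Suc i)) = 0"
    by (intro sum.neutral) auto
  then show ?case using Q_Suc[OF Suc.prems(1), of H n m] by simp
qed simp

lemma Q_tail_eq_0:
  assumes "1 \<le> s" "n < m + s - 1" "1 \<le> m"
  shows "Q_tail H n m s = 0"
  using assms by (auto simp: Q_tail_def intro!: sum.neutral Q_eq_0)

lemma Q_tail_Suc_eq_Q:
  assumes "1 \<le> m" "m \<le> n"
  shows "Q_tail H n m (Suc (n - m)) = Q H n m (Suc (n - m))"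
proof -
  have "(\<Sum>b=Suc (n - m)..n. Q H n m b) =
      Q H n m (Suc (n - m)) + (\<Sum>b=Suc (Suc (n - m))..n. Q H n m b)"
    using assms by (intro sum.atLeast_Suc_atMost) auto
  also have "(\<Sum>b=Suc (Suc (n - m))..n. Q H n m b) = 0"
    using assms by (intro sum.neutral) (auto intro!: Q_eq_0)
  finally show ?thesis using assms by (simp add: Q_tail_def)
qed

text \<open>From column \<open>n - m + 1\<close> the only tuple is
  \<open>a r = b r = n - m + r\<close>, so the value is the product of the last \<open>m\<close>
  diagonal entries. The induction peels these off one at a time.\<close>

lemma Q_leading_neq_0:
  assumes "H \<in> lower_tri_nz n" "1 \<le> m" "m \<le> n"
  shows "Q H n m (Suc (n - m)) \<noteq> 0"
  using assms(2,3)
proof (induction m)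
  case (Suc m)
  define j where "j = Suc (n - Suc m)"
  have j: "1 \<le> j" "j \<le> n" "Suc j = Suc (n - m)" using Suc.prems by (auto simp: j_def)
  have "Q H n (Suc m) j = H j j * Q_tail H n m (Suc j)
      + (\<Sum>i=Suc j..n. H i j * Q_tail H n m (Suc i))"
    unfolding Q_Suc[OF j(1)] using j by (intro sum.atLeast_Suc_atMost) auto
  also have "(\<Sum>i=Suc j..n. H i j * Q_tail H n m (Suc i)) = 0"
    using j Suc.prems by (intro sum.neutral) (auto intro!: Q_tail_eq_0 simp: j_def)
  finally have "Q H n (Suc m) j = H j j * Q_tail H n m (Suc (n - m))"
    using j by simp
  moreover have "H j j \<noteq> 0" using assms(1) j by (auto simp: lower_tri_nz_def)
  moreover have "Q_tail H n m (Suc (n - m)) \<noteq> 0"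
  proof (cases "m = 0")
    case False
    then show ?thesis using Suc by (simp add: Q_tail_Suc_eq_Q)
  qed (simp add: Q_tail_def)
  ultimately show ?case by (simp add: j_def)
qed simp

text \<open>Each column is recovered row by row from the top: order \<open>n - i + 1\<close> sees
  only rows up to \<open>i\<close>, with a nonzero coefficient at row \<open>i\<close>. The tails of
  both matrices agree, so the difference of two columns solves a homogeneous system.\<close>

lemma lower_tri_nz_eqI:
  assumes H: "H \<in> lower_tri_nz n" and H': "H' \<in> lower_tri_nz n"
    and eq: "\<And>j k. 1 \<le> j \<Longrightarrow> j \<le> n \<Longrightarrow> 1 \<le> k \<Longrightarrow> k + j \<le> Suc n \<Longrightarrow> Q H n k j = Q H' n k j"
  shows "H = H'"
proof -
  have Q_eq: "Q H n k j = Q H' n k j" if "1 \<le> j" "j \<le> n" "1 \<le> k" for j k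
    using that eq[of j k] Q_eq_0[of j n k] by (cases "k + j \<le> Suc n") auto
  have tail_eq: "Q_tail H n m (Suc i) = Q_tail H' n m (Suc i)" for m i
    by (auto simp: Q_tail_def intro!: sum.cong Q_eq)
  have entry_eq: "H i j = H' i j" if "1 \<le> j" "j \<le> i" "i \<le> n" for i j
    using that
  proof (induction i rule: less_induct)
    case (less i)
    \<comment> \<open>For this order the tail starting at \<open>Suc r\<close> vanishes when
      \<open>r > i\<close>, while rows \<open>r < i\<close> are settled by induction. At
      \<open>i = n\<close> the order is \<open>0\<close> and the tail is \<open>1\<close>.\<close>
    define m where "m = n - i"
    have "(\<Sum>r=j..n. (H r j - H' r j) * Q_tail H n m (Suc r)) = 0"
      using Q_eq[of j "Suc m"] less.prems Q_Suc[of j H n m] Q_Suc[of j H' n m]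
      by (simp add: left_diff_distrib sum_subtractf tail_eq)
    also have "(\<Sum>r=j..n. (H r j - H' r j) * Q_tail H n m (Suc r)) =
        (\<Sum>r\<in>{i}. (H r j - H' r j) * Q_tail H n m (Suc r))"
    proof (intro sum.mono_neutral_right ballI)
      fix r assume r: "r \<in> {j..n} - {i}"
      show "(H r j - H' r j) * Q_tail H n m (Suc r) = 0"
      proof (cases "r < i")
        case True
        then show ?thesis using less r by auto
      next
        case False
        then have "Q_tail H n m (Suc r) = 0 \<or> m = 0 \<and> r = i"
          using r less.prems by (intro disjI1 Q_tail_eq_0) (auto simp: m_def)
        then show ?thesis using r by auto
      qed
    qed (use less.prems in auto)
    finally have "(H i j - H' i j) * Q_tail H n m (Suc i) = 0" by simp
    moreover have "Q_tail H n m (Suc i) \<noteq> 0"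
    proof (cases "m = 0")
      case False
      then have "Suc i = Suc (n - m)" using less.prems by (auto simp: m_def)
      then show ?thesis using Q_tail_Suc_eq_Q[of m n H] Q_leading_neq_0[OF H, of m] False less.prems
        by (simp add: m_def)
    qed (simp add: Q_tail_def)
    ultimately show ?case by simp
  qed
  show ?thesis
  proof (intro ext)
    fix i j
    show "H i j = H' i j"
      using entry_eq[of j i] H H' by (cases "1 \<le> j \<and> j \<le> i \<and> i \<le> n") (auto simp: lower_tri_nz_def)
  qed
qed

section \<open>Alternating binomial sums\<close>

text \<open>By Pascal's rule, a finite difference of order \<open>Suc M\<close> is one of order
  \<open>M\<close> applied to first differences.\<close>

lemma alternating_sum_Suc:
  fixes f :: "nat \<Rightarrow> real"
  shows "(\<Sum>i\<le>Suc M. (-1) ^ i * real (Suc M choose i) * f i) =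
    (\<Sum>i\<le>M. (-1) ^ i * real (M choose i) * (f i - f (Suc i)))"
proof -
  have "(\<Sum>i\<le>Suc M. (-1) ^ i * real (Suc M choose i) * f i) =
      f 0 + (\<Sum>i\<le>M. (-1) ^ Suc i * real (Suc M choose Suc i) * f (Suc i))"
    by (subst sum.atMost_Suc_shift) simp
  also have "\<dots> = (f 0 + (\<Sum>i\<le>M. (-1) ^ Suc i * real (M choose Suc i) * f (Suc i)))
      - (\<Sum>i\<le>M. (-1) ^ i * real (M choose i) * f (Suc i))"
    by (simp add: algebra_simps sum.distrib sum_subtractf sum_negf)
  also have "f 0 + (\<Sum>i\<le>M. (-1) ^ Suc i * real (M choose Suc i) * f (Suc i)) =
      (\<Sum>i\<le>Suc M. (-1) ^ i * real (M choose i) * f i)"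
    by (subst sum.atMost_Suc_shift) simp
  also have "\<dots> = (\<Sum>i\<le>M. (-1) ^ i * real (M choose i) * f i)"
    by (simp add: binomial_eq_0)
  finally show ?thesis by (simp add: algebra_simps sum_subtractf)
qed

text \<open>The last binomial is a polynomial of degree \<open>m\<close> in \<open>i\<close>. Each
  difference lowers its degree by one and contributes a sign, so \<open>M\<close> of them annihilate
  every degree below \<open>M\<close>.\<close>

lemma alternating_sum_choose_add:
  "m \<le> M \<Longrightarrow> (\<Sum>i\<le>M. (-1) ^ i * real (M choose i) * real (x + i + m choose m)) =
    (if m = M then (-1) ^ M else 0)"
proof (induction M arbitrary: m x)
  case (Suc M)
  show ?case
  proof (cases m)
    case (Suc k)
    have "real (x + i + m choose m) - real (x + Suc i + m choose m) =
        - real (Suc x + i + k choose k)" for i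
      using Suc by simp
    then have "(\<Sum>i\<le>Suc M. (-1) ^ i * real (Suc M choose i) * real (x + i + m choose m)) =
        - (\<Sum>i\<le>M. (-1) ^ i * real (M choose i) * real (Suc x + i + k choose k))"
      unfolding alternating_sum_Suc by (simp only: sum_negf mult_minus_right)
    also have "\<dots> = (if m = Suc M then (-1) ^ Suc M else 0)"
      using Suc.IH[of k "Suc x"] Suc.prems Suc by simp
    finally show ?thesis .
  qed (simp only: alternating_sum_Suc, simp)
qed simp

text \<open>Summation by parts passes from the moments of \<open>u\<close> to those of its partial sums.\<close>

lemma alternating_choose_unique:
  fixes u :: "nat \<Rightarrow> real"
  assumes "\<And>m. m < M \<Longrightarrow> (\<Sum>i\<le>M. u i * real (x + i + m choose m)) = 0" "i \<le> M"
  shows "u i = (-1) ^ i * real (M choose i) * u 0"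
  using assms
proof (induction M arbitrary: u x i)
  case (Suc M)
  define U where "U i = (\<Sum>k\<le>i. u k)" for i
  have parts: "(\<Sum>i\<le>n. u i * f i) = U n * f n - (\<Sum>i<n. U i * (f (Suc i) - f i))"
    for f :: "nat \<Rightarrow> real" and n
    by (induction n) (simp_all add: U_def algebra_simps)
  \<comment> \<open>The moment of order \<open>0\<close> is the full sum of \<open>u\<close>. Its
    vanishing removes the boundary term of the summation by parts and shortens the range to
    \<open>M\<close>.\<close>
  have U_Suc_M: "U (Suc M) = 0"
    using Suc.prems(1)[of 0] by (simp add: U_def)
  \<comment> \<open>Differencing the weights lowers their order and raises \<open>x\<close> by one,
    so the partial sums meet the hypotheses for \<open>M\<close> and \<open>Suc x\<close>.\<close>
  have U: "U i = (-1) ^ i * real (M choose i) * U 0" if "i \<le> M" for i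
  proof (rule Suc.IH[OF _ that])
    fix m assume "m < M"
    have "0 = (\<Sum>i\<le>Suc M. u i * real (x + i + Suc m choose Suc m))"
      using Suc.prems(1)[of "Suc m"] \<open>m < M\<close> by simp
    also have "\<dots> = - (\<Sum>i<Suc M. U i * (real (x + Suc i + Suc m choose Suc m)
        - real (x + i + Suc m choose Suc m)))"
      unfolding parts U_Suc_M by simp
    also have "\<dots> = - (\<Sum>i\<le>M. U i * real (Suc x + i + m choose m))"
      by (simp add: lessThan_Suc_atMost)
    finally show "(\<Sum>i\<le>M. U i * real (Suc x + i + m choose m)) = 0" by simp
  qed
  show ?case
  proof (cases i)
    case (Suc k)
    have "u i = U i - U k" using Suc by (simp add: U_def)
    also have "U i = (-1) ^ i * real (M choose i) * U 0"
      using U[of i] U_Suc_M Suc.prems(2) by (cases "i = Suc M") auto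
    also have "U k = (-1) ^ k * real (M choose k) * U 0"
      using U[of k] Suc.prems(2) Suc by simp
    finally show ?thesis using Suc by (simp add: U_def algebra_simps)
  qed simp
qed simp

text \<open>The sum is the integral of \<open>t * (1 - t) ^ M\<close> over the unit interval, that
  is \<open>1 / ((M + 1) * (M + 2))\<close>.\<close>

lemma alternating_sum_choose_divide_pos:
  "(\<Sum>i\<le>M. (-1) ^ i * real (M choose i) / (real i + 2)) > 0"
proof -
  \<comment> \<open>An arbitrary positive \<open>x\<close> replaces \<open>2\<close> because
    differencing \<open>1 / (x + i)\<close> brings in \<open>x + 1\<close>.\<close>
  have "x > 0 \<Longrightarrow> (\<Sum>i\<le>M. (-1) ^ i * real (M choose i) * (1 / (x + real i))) =
      fact M / pochhammer x (Suc M)" for x :: real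
  proof (induction M arbitrary: x)
    case (Suc M)
    have pos: "pochhammer (x + 1) M > 0"
      using Suc.prems by (intro pochhammer_pos) simp
    have "(\<Sum>i\<le>Suc M. (-1) ^ i * real (Suc M choose i) * (1 / (x + real i))) =
       (\<Sum>i\<le>M. (-1) ^ i * real (M choose i) * (1 / (x + real i))) -
       (\<Sum>i\<le>M. (-1) ^ i * real (M choose i) * (1 / ((x + 1) + real i)))"
      unfolding alternating_sum_Suc by (simp add: algebra_simps sum_subtractf)
    also have "\<dots> = fact M / pochhammer x (Suc M) - fact M / pochhammer (x + 1) (Suc M)"
      using Suc.IH[of x] Suc.IH[of "x + 1"] Suc.prems by simp
    also have "pochhammer x (Suc M) = x * pochhammer (x + 1) M" by (rule pochhammer_rec)
    also have "pochhammer (x + 1) (Suc M) = pochhammer (x + 1) M * (x + 1 + real M)"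
      by (rule pochhammer_Suc)
    also have "fact M / (x * pochhammer (x + 1) M) -
        fact M / (pochhammer (x + 1) M * (x + 1 + real M)) =
        (x + 1 + real M - x) * fact M / (x * (pochhammer (x + 1) M * (x + 1 + real M)))"
    proof -
      have "a / (x * p) - a / (p * y) = (y - x) * a / (x * (p * y))"
        if "p > 0" "y > 0" for a p y :: real
        using that Suc.prems by (simp add: field_simps)
      then show ?thesis using pos Suc.prems by simp
    qed
    also have "(x + 1 + real M - x) * fact M = fact (Suc M)" by simp
    also have "x * (pochhammer (x + 1) M * (x + 1 + real M)) = pochhammer x (Suc (Suc M))"
      by (simp only: pochhammer_rec[of x "Suc M"] pochhammer_Suc[of "x + 1" M])
    finally show ?case .
  qed simp
  from this[of 2] have "(\<Sum>i\<le>M. (-1) ^ i * real (M choose i) / (real i + 2)) =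
      fact M / pochhammer 2 (Suc M)"
    by (simp add: add.commute)
  also have "\<dots> > 0" by (intro divide_pos_pos pochhammer_pos) auto
  finally show ?thesis .
qed

section \<open>Certificates as moments\<close>

text \<open>The factor of the double sum in \<open>H_cert\<close> that belongs to column
  \<open>j\<close>; \<open>m\<close> is the order of the Q-function of column \<open>k\<close> that
  it multiplies. Order \<open>0\<close> serves the row \<open>k = N\<close>.\<close>

definition cert_moment :: "nat \<Rightarrow> (nat \<Rightarrow> nat \<Rightarrow> real) \<Rightarrow> nat \<Rightarrow> nat \<Rightarrow> real" where
  "cert_moment N H j m = (\<Sum>l=1..N-j. (-1) ^ (l - 1) * real (l + m choose m) * Q H (N - 1) l j)"

lemma cert_moment_eq:
  assumes "j < N"
  shows "cert_moment N H j m =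
    (\<Sum>i\<le>N-j-1. (-1) ^ i * Q H (N - 1) (Suc i) j * real (1 + i + m choose m))"
proof -
  have "N - j = Suc (N - j - 1)" using assms by simp
  then have "{1..N-j} = Suc ` {..N-j-1}" by (metis One_nat_def image_Suc_atMost)
  then show ?thesis
    unfolding cert_moment_def by (simp add: sum.reindex mult_ac)
qed

lemma H_cert_last: "H_cert N H N j = real N * cert_moment N H j 0"
  by (simp add: H_cert_def cert_moment_def)

lemma H_cert_eq_sum_moments:
  assumes "k \<noteq> N"
  shows "H_cert N H k j =
    real N * (\<Sum>m=1..N-k. cert_moment N H j m * ((-1) ^ m * Q H (N - 1) m k))"
proof -
  have "(\<Sum>l=1..N-j. \<Sum>m=1..N-k. (-1) ^ (l + m - 1) * real ((l + m) choose m) *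
      Q H (N - 1) l j * Q H (N - 1) m k) =
    (\<Sum>l=1..N-j. \<Sum>m=1..N-k. (-1) ^ (l - 1) * real ((l + m) choose m) *
      Q H (N - 1) l j * ((-1) ^ m * Q H (N - 1) m k))"
  proof (intro sum.cong refl)
    fix l m assume "l \<in> {1..N-j}"
    then have "l + m - 1 = (l - 1) + m" by simp
    then have "(-1 :: real) ^ (l + m - 1) = (-1) ^ (l - 1) * (-1) ^ m"
      by (simp only: power_add)
    then show "(-1) ^ (l + m - 1) * real ((l + m) choose m) * Q H (N - 1) l j * Q H (N - 1) m k =
      (-1) ^ (l - 1) * real ((l + m) choose m) * Q H (N - 1) l j * ((-1) ^ m * Q H (N - 1) m k)"
      by simp
  qed
  also have "\<dots> = (\<Sum>m=1..N-k. cert_moment N H j m * ((-1) ^ m * Q H (N - 1) m k))"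
    unfolding cert_moment_def sum_distrib_right by (rule sum.swap)
  finally show ?thesis using assms by (simp add: H_cert_def)
qed

text \<open>The certificate in row \<open>k\<close> involves moments of order at most
  \<open>N - k\<close>, the highest with the nonzero factor \<open>Q H (N - 1) (N - k) k\<close>.
  The system is triangular and is solved from \<open>k = N - 1\<close> downwards.\<close>

lemma H_cert_eq_0_iff_moments:
  assumes H: "H \<in> lower_tri_nz (N - 1)" and k\<^sub>0: "1 \<le> k\<^sub>0"
  shows "(\<forall>k\<in>{k\<^sub>0..N-1}. H_cert N H k j = 0) \<longleftrightarrow> (\<forall>m\<in>{1..N-k\<^sub>0}. cert_moment N H j m = 0)"
proof (intro iffI ballI)
  fix m assume cert: "\<forall>k\<in>{k\<^sub>0..N-1}. H_cert N H k j = 0" and "m \<in> {1..N-k\<^sub>0}"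
  then show "cert_moment N H j m = 0"
  proof (induction m rule: less_induct)
    case (less m)
    define k where "k = N - m"
    have k: "k \<in> {k\<^sub>0..N-1}" "k \<noteq> N" "N - k = m" "k = Suc (N - 1 - m)"
      using less.prems k\<^sub>0 by (auto simp: k_def)
    have "(\<Sum>r=1..m. cert_moment N H j r * ((-1) ^ r * Q H (N - 1) r k)) =
        (\<Sum>r\<in>{m}. cert_moment N H j r * ((-1) ^ r * Q H (N - 1) r k))"
      using less.IH less.prems by (intro sum.mono_neutral_right) auto
    then have "cert_moment N H j m * ((-1) ^ m * Q H (N - 1) m k) = 0"
      using H_cert_eq_sum_moments[OF k(2), of H j] k cert by auto
    moreover have "Q H (N - 1) m k \<noteq> 0"
      using Q_leading_neq_0[OF H, of m] less.prems k k\<^sub>0 by simp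
    ultimately show ?case by simp
  qed
next
  fix k assume "\<forall>m\<in>{1..N-k\<^sub>0}. cert_moment N H j m = 0" "k \<in> {k\<^sub>0..N-1}"
  then show "H_cert N H k j = 0"
    using k\<^sub>0 H_cert_eq_sum_moments[of k N H j]
    by (cases "N = 0") (auto intro!: sum.neutral)
qed

text \<open>Applied to \<open>u i = (-1) ^ i * v i\<close>, the two preceding results say that the
  alternating binomial row spans the sequences orthogonal to all polynomials of degree below
  \<open>M\<close>.\<close>

lemma alternating_choose_iff:
  fixes v :: "nat \<Rightarrow> real"
  shows "(\<forall>m\<in>{..<M}. (\<Sum>i\<le>M. (-1) ^ i * v i * real (x + i + m choose m)) = 0) \<longleftrightarrow>
    (\<exists>t. \<forall>i\<in>{..M}. v i = t * real (M choose i))"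
proof
  assume zero: "\<forall>m\<in>{..<M}. (\<Sum>i\<le>M. (-1) ^ i * v i * real (x + i + m choose m)) = 0"
  have "v i = v 0 * real (M choose i)" if "i \<in> {..M}" for i
  proof -
    have "(-1) ^ i * v i = (-1) ^ i * real (M choose i) * ((-1) ^ 0 * v 0)"
      using zero that by (intro alternating_choose_unique[where x = x]) blast+
    then show ?thesis by simp
  qed
  then show "\<exists>t. \<forall>i\<in>{..M}. v i = t * real (M choose i)" by blast
next
  assume "\<exists>t. \<forall>i\<in>{..M}. v i = t * real (M choose i)"
  then obtain t where t: "\<And>i. i \<in> {..M} \<Longrightarrow> v i = t * real (M choose i)" by blast
  show "\<forall>m\<in>{..<M}. (\<Sum>i\<le>M. (-1) ^ i * v i * real (x + i + m choose m)) = 0"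
  proof
    fix m assume m: "m \<in> {..<M}"
    have "(\<Sum>i\<le>M. (-1) ^ i * v i * real (x + i + m choose m)) =
        t * (\<Sum>i\<le>M. (-1) ^ i * real (M choose i) * real (x + i + m choose m))"
      unfolding sum_distrib_left by (intro sum.cong refl) (simp only: t mult_ac)
    also have "\<dots> = 0"
      using m by (subst alternating_sum_choose_add) auto
    finally show "(\<Sum>i\<le>M. (-1) ^ i * v i * real (x + i + m choose m)) = 0" .
  qed
qed

lemma moments_from_0_iff:
  assumes "j < N"
  shows "(\<forall>m\<in>{..<N-j-1}. cert_moment N H j m = 0) \<longleftrightarrow>
    (\<exists>t. \<forall>i\<in>{..N-j-1}. Q H (N - 1) (Suc i) j = t * real (N - j - 1 choose i))"
  unfolding cert_moment_eq[OF assms] by (rule alternating_choose_iff)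

text \<open>Absorption, \<open>(m + 1) * (i + m + 2 choose m + 1) = (i + 2) * (i + m + 2 choose
  m)\<close>, turns the moment of order \<open>m + 1\<close> into one of order \<open>m\<close> for
  the sequence weighted by \<open>i + 2\<close>, with \<open>x = 2\<close>.\<close>

lemma moments_from_1_iff:
  assumes "j < N"
  shows "(\<forall>m\<in>{1..N-j-1}. cert_moment N H j m = 0) \<longleftrightarrow>
    (\<exists>t. \<forall>i\<in>{..N-j-1}. (real i + 2) * Q H (N - 1) (Suc i) j = t * real (N - j - 1 choose i))"
proof -
  have absorb: "real (Suc m) * real (1 + i + Suc m choose Suc m) =
      (real i + 2) * real (2 + i + m choose m)" for i m
  proof -
    have "Suc m * (Suc (m + Suc i) choose Suc m) = Suc (Suc i) * (Suc (m + Suc i) choose m)"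
      by (rule Suc_times_binomial_add)
    moreover have "Suc (m + Suc i) = 1 + i + Suc m" "Suc (m + Suc i) = 2 + i + m" by auto
    ultimately have "real (Suc m * (1 + i + Suc m choose Suc m)) =
        real (Suc (Suc i) * (2 + i + m choose m))" by metis
    then show ?thesis by (simp only: of_nat_mult of_nat_Suc) simp
  qed
  have moment: "real (Suc m) * cert_moment N H j (Suc m) =
      (\<Sum>i\<le>N-j-1. (-1) ^ i * ((real i + 2) * Q H (N - 1) (Suc i) j) * real (2 + i + m choose m))"
    for m
    unfolding cert_moment_eq[OF assms] sum_distrib_left
  proof (intro sum.cong refl)
    fix i
    have "real (Suc m) * ((-1) ^ i * Q H (N - 1) (Suc i) j * real (1 + i + Suc m choose Suc m)) =
        (-1) ^ i * Q H (N - 1) (Suc i) j * (real (Suc m) * real (1 + i + Suc m choose Suc m))"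
      by (simp only: mult_ac)
    then show "real (Suc m) * ((-1) ^ i * Q H (N - 1) (Suc i) j * real (1 + i + Suc m choose Suc m)) =
        (-1) ^ i * ((real i + 2) * Q H (N - 1) (Suc i) j) * real (2 + i + m choose m)"
      unfolding absorb by (simp only: mult_ac)
  qed
  have "(\<forall>m\<in>{1..N-j-1}. cert_moment N H j m = 0) \<longleftrightarrow>
      (\<forall>m\<in>{..<N-j-1}. real (Suc m) * cert_moment N H j (Suc m) = 0)"
  proof -
    have "{1..N-j-1} = Suc ` {..<N-j-1}" by (simp add: image_Suc_lessThan)
    then show ?thesis by (simp del: of_nat_Suc)
  qed
  then show ?thesis unfolding moment by (simp only: alternating_choose_iff)
qed

section \<open>Columns with vanishing certificates\<close>

lemma Q_value_top_neq_0:
  assumes "1 \<le> j" "j < N" "N' \<le> N"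
  shows "Q_value N N' (N - j) j \<noteq> 0"
  using assms by (auto simp: Q_value_def)

text \<open>With \<open>k = i + 1\<close>, the weight \<open>i + 2\<close> of the moment criterion
  becomes the denominator \<open>k + 1\<close> of \<open>Q_value\<close>.\<close>

lemma certs_low_iff:
  assumes H: "H \<in> lower_tri_nz (N - 1)" and j: "1 \<le> j" "j < N'" "N' \<le> N"
  shows "(\<forall>k\<in>{j+1..N-1}. H_cert N H k j = 0) \<longleftrightarrow>
    (\<exists>t. \<forall>k\<in>{1..N-j}. Q H (N - 1) k j = t * Q_value N N' k j)"
proof -
  have set: "{1..N-j} = Suc ` {..N-j-1}"
    using j by (simp add: image_Suc_atMost)
  have "(\<forall>k\<in>{j+1..N-1}. H_cert N H k j = 0) \<longleftrightarrow> (\<forall>m\<in>{1..N-j-1}. cert_moment N H j m = 0)"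
    using H_cert_eq_0_iff_moments[OF H, of "j + 1" j] by simp
  also have "\<dots> \<longleftrightarrow> (\<exists>t. \<forall>i\<in>{..N-j-1}. (real i + 2) * Q H (N - 1) (Suc i) j =
      t * real (N - j - 1 choose i))"
    using j by (intro moments_from_1_iff) auto
  also have "\<dots> \<longleftrightarrow> (\<exists>t. \<forall>k\<in>{1..N-j}. Q H (N - 1) k j = t * Q_value N N' k j)"
    unfolding set using j by (simp add: Q_value_def field_simps)
  finally show ?thesis .
qed

text \<open>Row \<open>N\<close> supplies the moment of order \<open>0\<close>, and rows
  \<open>j + 2\<close> to \<open>N - 1\<close> supply those of orders \<open>1\<close> to
  \<open>N - j - 2\<close>.\<close>

lemma certs_high_iff:
  assumes H: "H \<in> lower_tri_nz (N - 1)" and j: "1 \<le> N'" "N' \<le> j" "j < N"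
  shows "(\<forall>k\<in>{j+2..N}. H_cert N H k j = 0) \<longleftrightarrow>
    (\<exists>t. \<forall>k\<in>{1..N-j}. Q H (N - 1) k j = t * Q_value N N' k j)"
proof -
  define c where "c = (real j - real N' + 1) / (real N - real N' + 1)"
  have c: "c \<noteq> 0" using j by (auto simp: c_def)
  have set: "{1..N-j} = Suc ` {..N-j-1}"
    using j by (simp add: image_Suc_atMost)
  have "(\<forall>k\<in>{j+2..N}. H_cert N H k j = 0) \<longleftrightarrow> (\<forall>m\<in>{..<N-j-1}. cert_moment N H j m = 0)"
  \<comment> \<open>Otherwise \<open>j = N - 1\<close>, and both conditions are vacuous.\<close>
  proof (cases "j + 2 \<le> N")
    case True
    have sets: "{j+2..N} = insert N {j+2..N-1}" "{..<N-j-1} = insert 0 {1..N-(j+2)}"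
      using True by auto
    have "H_cert N H N j = 0 \<longleftrightarrow> cert_moment N H j 0 = 0"
      using j by (simp add: H_cert_last)
    moreover have "(\<forall>k\<in>{j+2..N-1}. H_cert N H k j = 0) \<longleftrightarrow>
        (\<forall>m\<in>{1..N-(j+2)}. cert_moment N H j m = 0)"
      by (rule H_cert_eq_0_iff_moments[OF H]) simp
    ultimately show ?thesis unfolding sets ball_insert by blast
  qed auto
  also have "\<dots> \<longleftrightarrow> (\<exists>t. \<forall>i\<in>{..N-j-1}. Q H (N - 1) (Suc i) j = t * real (N - j - 1 choose i))"
    by (rule moments_from_0_iff[OF j(3)])
  also have "\<dots> \<longleftrightarrow> (\<exists>t. \<forall>i\<in>{..N-j-1}. Q H (N - 1) (Suc i) j = t * (c * real (N - j - 1 choose i)))"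
  proof
    assume "\<exists>t. \<forall>i\<in>{..N-j-1}. Q H (N - 1) (Suc i) j = t * real (N - j - 1 choose i)"
    then obtain t where "\<forall>i\<in>{..N-j-1}. Q H (N - 1) (Suc i) j = t * real (N - j - 1 choose i)" ..
    then show "\<exists>t. \<forall>i\<in>{..N-j-1}. Q H (N - 1) (Suc i) j = t * (c * real (N - j - 1 choose i))"
      using c by (intro exI[of _ "t / c"]) simp
  qed (metis mult.assoc)
  also have "\<dots> \<longleftrightarrow> (\<exists>t. \<forall>k\<in>{1..N-j}. Q H (N - 1) k j = t * Q_value N N' k j)"
    unfolding set using j by (simp add: Q_value_def c_def)
  finally show ?thesis .
qed

section \<open>Tail sums of the prescribed Q-functions\<close>

text \<open>The closed form of the sum of \<open>Q_value N N' m b\<close> over \<open>b\<close> from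
  \<open>s\<close> to \<open>N - 1\<close> when \<open>m \<ge> 1\<close>. At \<open>m = 0\<close> it
  equals \<open>1\<close>, the convention of \<open>Q_tail\<close>.\<close>

definition Q_value_tail :: "nat \<Rightarrow> nat \<Rightarrow> nat \<Rightarrow> nat \<Rightarrow> real" where
  "Q_value_tail N N' m s = (if s < N' then real (N - s choose m) / (real m + 1)
     else ((real s - real N' + 1) * real (N - s choose m) + real (N - s choose Suc m))
       / (real N - real N' + 1))"

text \<open>The two branches agree at \<open>s = N'\<close>, so sums that start below
  \<open>N'\<close> can cross the boundary.\<close>

lemma Q_value_tail_low:
  assumes "s \<le> N'" "N' \<le> N"
  shows "Q_value_tail N N' m s = real (N - s choose m) / (real m + 1)"
proof (cases "s < N'")
  case False
  then have s: "s = N'" using assms by simp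
  have "real (Suc m) * real (Suc (N - N') choose Suc m) = real (Suc (N - N')) * real (N - N' choose m)"
    using Suc_times_binomial[of m "N - N'"] by (metis of_nat_mult)
  then have "(real m + 1) * (real (N - N' choose m) + real (N - N' choose Suc m)) =
      (real N - real N' + 1) * real (N - N' choose m)"
    using assms by (simp add: of_nat_diff algebra_simps)
  then show ?thesis using assms unfolding Q_value_tail_def s by (simp add: field_simps)
qed (simp add: Q_value_tail_def)

lemma Q_value_tail_0:
  assumes "s \<le> N" "N' \<le> N"
  shows "Q_value_tail N N' 0 s = 1"
  using assms by (auto simp: Q_value_tail_def of_nat_diff field_simps)

lemma Q_value_tail_rec:
  assumes "1 \<le> m" "s < N" "N' \<le> N"
  shows "Q_value_tail N N' m s = Q_value N N' m s + Q_value_tail N N' m (Suc s)"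
proof -
  obtain r k where r: "N - s = Suc r" "N - Suc s = r" "N - s - 1 = r" and k: "m = Suc k"
    using assms by (metis Suc_diff_Suc Suc_le_D One_nat_def diff_Suc_1)
  show ?thesis
  proof (cases "s < N'")
    case True
    then show ?thesis
      using assms by (simp add: Q_value_tail_low Q_value_def r k add_divide_distrib[symmetric])
  next
    case False
    have "real N - real N' + 1 > 0" using assms by simp
    then show ?thesis using False
      by (simp add: Q_value_tail_def Q_value_def r k add_divide_distrib[symmetric] algebra_simps)
  qed
qed

lemma sum_Q_value:
  assumes "1 \<le> m" "s \<le> N" "N' \<le> N" "1 \<le> N"
  shows "(\<Sum>b=s..N-1. Q_value N N' m b) = Q_value_tail N N' m s"
  using assms(2)
proof (induction rule: inc_induct)
  case base
  then show ?case using assms by (auto simp: Q_value_tail_def)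
next
  case (step s)
  have "(\<Sum>b=s..N-1. Q_value N N' m b) = Q_value N N' m s + (\<Sum>b=Suc s..N-1. Q_value N N' m b)"
    using step by (intro sum.atLeast_Suc_atMost) auto
  then show ?case using step Q_value_tail_rec[of m s N N'] assms by simp
qed

text \<open>The sum is the tail at \<open>s = 1\<close>, which the low formula covers for every
  \<open>N'\<close>; the result is therefore independent of \<open>N'\<close>.\<close>

lemma sum_Q_value_invariant:
  assumes "1 \<le> m" "m < N" "1 \<le> N'" "N' \<le> N"
  shows "(\<Sum>j=1..N-m. Q_value N N' m j) = 1 / real N * real (N choose (m + 1))"
proof -
  have "(\<Sum>j=1..N-m. Q_value N N' m j) = (\<Sum>j=1..N-1. Q_value N N' m j)"
    using assms by (intro sum.mono_neutral_left) (auto simp: Q_value_def)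
  also have "\<dots> = real (N - 1 choose m) / (real m + 1)"
    using assms by (subst sum_Q_value) (simp_all add: Q_value_tail_low)
  also have "\<dots> = 1 / real N * real (N choose (m + 1))"
  proof -
    have "real (Suc m) * real (N choose Suc m) = real N * real (N - 1 choose m)"
      using Suc_times_binomial[of m "N - 1"] assms by (simp only: of_nat_mult[symmetric]) simp
    then show ?thesis using assms by (simp add: field_simps)
  qed
  finally show ?thesis .
qed

text \<open>The certificates make every column proportional to the prescribed one; invariance then
  forces each factor to be \<open>1\<close>, column by column from the left.\<close>

lemma certs_iff_Q_value:
  assumes H: "H \<in> lower_tri_nz (N - 1)" and N': "1 \<le> N'" "N' \<le> N"
  shows "((\<forall>j\<in>{1..N'-1}. \<forall>k\<in>{j+1..N-1}. H_cert N H k j = 0) \<and>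
      (\<forall>j\<in>{N'..N-1}. \<forall>k\<in>{j+2..N}. H_cert N H k j = 0) \<and> H_invariant N H)
    \<longleftrightarrow> (\<forall>j\<in>{1..N-1}. \<forall>k\<in>{1..N-j}. Q H (N - 1) k j = Q_value N N' k j)"
    (is "?low \<and> ?high \<and> _ \<longleftrightarrow> ?values")
proof -
  have "?low \<longleftrightarrow> (\<forall>j\<in>{1..N'-1}. \<exists>t. \<forall>k\<in>{1..N-j}. Q H (N - 1) k j = t * Q_value N N' k j)"
    using N' by (intro ball_cong refl certs_low_iff[OF H]) auto
  moreover have "?high \<longleftrightarrow> (\<forall>j\<in>{N'..N-1}. \<exists>t. \<forall>k\<in>{1..N-j}. Q H (N - 1) k j = t * Q_value N N' k j)"
    using N' by (intro ball_cong refl certs_high_iff[OF H]) auto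
  moreover have "{1..N-1} = {1..N'-1} \<union> {N'..N-1}" using N' by auto
  ultimately have "?low \<and> ?high \<longleftrightarrow>
      (\<forall>j\<in>{1..N-1}. \<exists>t. \<forall>k\<in>{1..N-j}. Q H (N - 1) k j = t * Q_value N N' k j)"
    by (simp only: ball_Un)
  moreover have "(\<forall>j\<in>{1..N-1}. \<exists>t. \<forall>k\<in>{1..N-j}. Q H (N - 1) k j = t * Q_value N N' k j) \<and>
      H_invariant N H \<longleftrightarrow> ?values"
  proof (intro iffI conjI)
    assume A: "(\<forall>j\<in>{1..N-1}. \<exists>t. \<forall>k\<in>{1..N-j}. Q H (N - 1) k j = t * Q_value N N' k j) \<and>
      H_invariant N H"
    have "\<forall>k\<in>{1..N-j}. Q H (N - 1) k j = Q_value N N' k j" if "j \<in> {1..N-1}" for j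
      using that
    proof (induction j rule: less_induct)
      case (less j)
      \<comment> \<open>At this order the invariance sum stops at column \<open>j\<close>, where the
        prescribed value is nonzero, and the columns before it are known.\<close>
      define m where "m = N - j"
      have m: "m \<in> {1..N-1}" "N - m = j" using less.prems by (auto simp: m_def)
      obtain t where t: "\<And>k. k \<in> {1..N-j} \<Longrightarrow> Q H (N - 1) k j = t * Q_value N N' k j"
        using A less.prems by blast
      have "(\<Sum>i=1..j. Q H (N - 1) m i) = (\<Sum>i=1..j. Q_value N N' m i)"
        using A m N' sum_Q_value_invariant[of m N N'] by (auto simp: H_invariant_def)
      moreover have "{1..j} = insert j {1..<j}" using less.prems by auto
      moreover have "(\<Sum>i=1..<j. Q H (N - 1) m i) = (\<Sum>i=1..<j. Q_value N N' m i)"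
        using less.IH less.prems m by (intro sum.cong) (auto simp: m_def)
      ultimately have "Q H (N - 1) m j = Q_value N N' m j" by simp
      moreover have "Q H (N - 1) m j = t * Q_value N N' m j"
        using less.prems by (intro t) (auto simp: m_def)
      moreover have "Q_value N N' m j \<noteq> 0"
        unfolding m_def using less.prems N' by (intro Q_value_top_neq_0) auto
      ultimately have "t = 1" by simp
      then show ?case using t by simp
    qed
    then show ?values by blast
  next
    assume ?values
    then show "\<forall>j\<in>{1..N-1}. \<exists>t. \<forall>k\<in>{1..N-j}. Q H (N - 1) k j = t * Q_value N N' k j"
      by (metis mult_1)
  next
    assume vals: ?values
    show "H_invariant N H"
      unfolding H_invariant_def
    proof
      fix m assume m: "m \<in> {1..N-1}"
      have "(\<Sum>j=1..N-m. Q H (N - 1) m j) = (\<Sum>j=1..N-m. Q_value N N' m j)"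
        using vals m by (intro sum.cong) auto
      also have "\<dots> = 1 / real N * real (N choose (m + 1))"
        by (rule sum_Q_value_invariant) (use m N' in auto)
      finally show "(\<Sum>j=1..N-m. Q H (N - 1) m j) = 1 / real N * real (N choose (m + 1))" .
    qed
  qed
  ultimately show ?thesis by blast
qed

section \<open>Positivity of the remaining certificates\<close>

lemma H_cert_last_pos:
  assumes "\<And>k. k \<in> {1..N-j} \<Longrightarrow> Q H (N - 1) k j = Q_value N N' k j" "j < N'" "N' \<le> N"
  shows "H_cert N H N j > 0"
proof -
  have "cert_moment N H j 0 =
      (\<Sum>i\<le>N-j-1. (-1) ^ i * real (N - j - 1 choose i) / (real i + 2))"
    using assms by (subst cert_moment_eq) (auto simp: Q_value_def intro!: sum.cong)
  then show ?thesis
    using assms alternating_sum_choose_divide_pos[of "N - j - 1"] by (simp add: H_cert_last)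
qed

text \<open>The moments of column \<open>j\<close> vanish below order \<open>M = N - j - 1\<close>,
  so only the top summand of the certificate survives and the value is
  \<open>N * c j * c (j + 1)\<close>.\<close>

lemma H_cert_Suc_pos:
  assumes val: "\<And>j k. j \<in> {N'..N-1} \<Longrightarrow> k \<in> {1..N-j} \<Longrightarrow> Q H (N - 1) k j = Q_value N N' k j"
    and j: "N' \<le> j" "j < N"
  shows "H_cert N H (j + 1) j > 0"
proof -
  define c where "c i = (real i - real N' + 1) / (real N - real N' + 1)" for i
  define M where "M = N - j - 1"
  have c_pos: "c i > 0" if "N' \<le> i" for i
    using that j by (auto simp: c_def)
  have Q_eq: "Q H (N - 1) (Suc i) j = c j * real (M choose i)" if "i \<le> M" for i
    using val[of j "Suc i"] j that by (auto simp: Q_value_def c_def M_def)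
  have moment: "cert_moment N H j m = (if m = M then c j * (-1) ^ M else 0)" if "m \<le> M" for m
  proof -
    have "cert_moment N H j m =
        (\<Sum>i\<le>M. c j * ((-1) ^ i * real (M choose i) * real (1 + i + m choose m)))"
      unfolding cert_moment_eq[OF j(2)] M_def[symmetric]
      by (intro sum.cong) (simp_all add: Q_eq[simplified])
    then show ?thesis
      unfolding sum_distrib_left[symmetric] alternating_sum_choose_add[OF that] by simp
  qed
  show ?thesis
  \<comment> \<open>For \<open>j = N - 1\<close> the certificate lies in row \<open>N\<close> and is
    given by the other branch of \<open>H_cert\<close>.\<close>
  proof (cases "M = 0")
    case True
    then have "j + 1 = N" using j by (simp add: M_def)
    then show ?thesis
      using moment[of 0] True c_pos[OF j(1)] by (simp add: H_cert_last)
  next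
    case False
    then have M: "N - (j + 1) = M" "j + 1 \<noteq> N" "1 \<le> M" by (auto simp: M_def)
    have "(\<Sum>m=1..M. cert_moment N H j m * ((-1) ^ m * Q H (N - 1) m (j + 1))) =
        (\<Sum>m\<in>{M}. cert_moment N H j m * ((-1) ^ m * Q H (N - 1) m (j + 1)))"
      using M by (intro sum.mono_neutral_right) (auto simp: moment)
    also have "\<dots> = c j * c (j + 1)"
      using M j val[of "j + 1" M]
      by (auto simp: moment Q_value_def c_def M_def simp flip: power_add)
    finally show ?thesis
      using M j c_pos[of j] c_pos[of "j + 1"] by (simp add: H_cert_eq_sum_moments)
  qed
qed

section \<open>The explicit matrix\<close>

text \<open>Below the diagonal each entry is minus a row factor times a column factor, which lets
  the iterates be written with running weighted sums. With \<open>K = N - N' + 1\<close>, the row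
  factor \<open>K / 2\<close> of the lower left block continues the tail sums of the upper left
  block across row \<open>N'\<close>.\<close>

definition hybrid :: "nat \<Rightarrow> nat \<Rightarrow> nat \<Rightarrow> nat \<Rightarrow> real" where
  "hybrid N N' i j =
     (if \<not> (1 \<le> j \<and> j \<le> i \<and> i \<le> N - 1) then 0
      else if j < N' then
        (if i = j then (real N - real j) / (real N - real j + 1)
         else - (if i < N' then real N - real i else (real N - real N' + 1) / 2)
           / ((real N - real j) * (real N - real j + 1)))
      else
        (if i = j then (real j - real N' + 1) / (real j - real N' + 2)
         else - (real j - real N' + 1) / ((real i - real N' + 1) * (real i - real N' + 2))))"

lemma hybrid_in_lower_tri_nz: "hybrid N N' \<in> lower_tri_nz (N - 1)"
  by (auto simp: lower_tri_nz_def hybrid_def)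

section \<open>Weighted tail sums and the columns of the explicit matrix\<close>

lemma sum_Q_value_tail_high_weighted:
  assumes "N' \<le> s" "s \<le> N - 1" "N' < N"
  shows "(\<Sum>i=Suc s..N-1. Q_value_tail N N' m (Suc i) /
      ((real i - real N' + 1) * (real i - real N' + 2))) =
    real (N - s - 1 choose Suc m) / ((real N - real N' + 1) * (real s - real N' + 2))"
  using assms(2,1)
proof (induction rule: inc_induct)
  case (step s)
  define p where "p = real s - real N' + 2"
  define K where "K = real N - real N' + 1"
  have pos: "p > 0" "K > 0" using step assms by (auto simp: p_def K_def)
  define r where "r = N - Suc (Suc s)"
  have r: "N - s - 1 = Suc r" "N - Suc s - 1 = r" "N - Suc (Suc s) = r"
    using step by (auto simp: r_def)
  have "(\<Sum>i=Suc s..N-1. Q_value_tail N N' m (Suc i) /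
      ((real i - real N' + 1) * (real i - real N' + 2))) =
    Q_value_tail N N' m (Suc (Suc s)) / (p * (p + 1)) +
    (\<Sum>i=Suc (Suc s)..N-1. Q_value_tail N N' m (Suc i) /
      ((real i - real N' + 1) * (real i - real N' + 2)))"
    using step by (subst sum.atLeast_Suc_atMost) (auto simp: p_def algebra_simps)
  also have "\<dots> = ((p + 1) * real (r choose m) + real (r choose Suc m)) / K / (p * (p + 1)) +
      real (r choose Suc m) / (K * (p + 1))"
    using step by (simp add: Q_value_tail_def r p_def K_def algebra_simps)
  also have "\<dots> = (real (r choose m) + real (r choose Suc m)) / (K * p)"
    using pos by (simp add: divide_simps) (simp add: algebra_simps)
  finally show ?case unfolding r p_def K_def by simp
qed simp

lemma sum_Q_value_tail_high:
  assumes "s \<le> N" "N' \<le> s" "N' < N"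
  shows "(\<Sum>i=s..N-1. Q_value_tail N N' m (Suc i)) =
    ((real s - real N' + 2) * real (N - s choose Suc m) + 2 * real (N - s choose Suc (Suc m)))
      / (real N - real N' + 1)"
  using assms(1,2)
proof (induction rule: inc_induct)
  case base
  then show ?case using assms by simp
next
  case (step s)
  define K where "K = real N - real N' + 1"
  have pos: "K > 0" using assms by (auto simp: K_def)
  define r where "r = N - Suc s"
  have r: "N - s = Suc r" "N - Suc s = r"
    using step by (auto simp: r_def)
  have "(\<Sum>i=s..N-1. Q_value_tail N N' m (Suc i)) =
      Q_value_tail N N' m (Suc s) + (\<Sum>i=Suc s..N-1. Q_value_tail N N' m (Suc i))"
    using step by (intro sum.atLeast_Suc_atMost) auto
  then show ?case using step pos
    by (simp add: Q_value_tail_def r K_def[symmetric] add_divide_distrib[symmetric] algebra_simps)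
qed

text \<open>Absorption turns \<open>(N - s)\<close> times the tail at \<open>Suc s\<close> into
  \<open>N - s choose Suc m\<close>, and Pascal's rule adds these up. At \<open>s = N'\<close> the
  unweighted high sum times \<open>K / 2\<close>, with \<open>K = N - N' + 1\<close>, already has
  the required form.\<close>

lemma sum_Q_value_tail_low_weighted:
  assumes "s \<le> N'" "N' < N"
  shows "(\<Sum>i=s..N-1. (if i < N' then real N - real i else (real N - real N' + 1) / 2) *
      Q_value_tail N N' m (Suc i)) = real (Suc (N - s) choose Suc (Suc m))"
  using assms(1)
proof (induction rule: inc_induct)
  case base
  have cancel: "K / 2 * ((2 * a + 2 * b) / K) = a + b" if "K > 0" for a b K :: real
    using that by (simp add: field_simps)
  have "(\<Sum>i=N'..N-1. (if i < N' then real N - real i else (real N - real N' + 1) / 2) *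
      Q_value_tail N N' m (Suc i)) =
    (\<Sum>i=N'..N-1. (real N - real N' + 1) / 2 * Q_value_tail N N' m (Suc i))"
    by (intro sum.cong) auto
  also have "\<dots> = (real N - real N' + 1) / 2 *
      ((2 * real (N - N' choose Suc m) + 2 * real (N - N' choose Suc (Suc m)))
        / (real N - real N' + 1))"
    unfolding sum_distrib_left[symmetric] using assms by (subst sum_Q_value_tail_high) auto
  also have "\<dots> = real (N - N' choose Suc m) + real (N - N' choose Suc (Suc m))"
    by (rule cancel) (use assms in simp)
  also have "\<dots> = real (Suc (N - N') choose Suc (Suc m))" by simp
  finally show ?case .
next
  case (step s)
  define r where "r = N - Suc s"
  have r: "N - s = Suc r" "N - Suc s = r" "real N - real s = real (Suc r)"
    using step assms by (auto simp: r_def of_nat_diff)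
  have "real (Suc m) * real (Suc r choose Suc m) = real (Suc r) * real (r choose m)"
    using Suc_times_binomial[of m r] by (metis of_nat_mult)
  then have "(real N - real s) * Q_value_tail N N' m (Suc s) = real (Suc r choose Suc m)"
    using step assms by (subst Q_value_tail_low) (simp_all add: r field_simps)
  moreover have "(\<Sum>i=s..N-1. (if i < N' then real N - real i else (real N - real N' + 1) / 2) *
      Q_value_tail N N' m (Suc i)) =
    (real N - real s) * Q_value_tail N N' m (Suc s) +
    (\<Sum>i=Suc s..N-1. (if i < N' then real N - real i else (real N - real N' + 1) / 2) *
      Q_value_tail N N' m (Suc i))"
    using step assms by (subst sum.atLeast_Suc_atMost) auto
  ultimately show ?case using step.IH by (simp add: r)
qed

text \<open>This is the recursion for \<open>Q\<close> with the prescribed tails inserted: the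
  diagonal term and the weighted sum below it combine to the next prescribed value.\<close>

lemma hybrid_column:
  assumes "1 \<le> j" "j \<le> N - 1" "1 \<le> N'" "N' < N"
  shows "(\<Sum>i=j..N-1. hybrid N N' i j * Q_value_tail N N' m (Suc i)) = Q_value N N' (Suc m) j"
proof -
  have split: "(\<Sum>i=j..N-1. hybrid N N' i j * Q_value_tail N N' m (Suc i)) =
      hybrid N N' j j * Q_value_tail N N' m (Suc j) +
      (\<Sum>i=Suc j..N-1. hybrid N N' i j * Q_value_tail N N' m (Suc i))"
    using assms by (intro sum.atLeast_Suc_atMost) auto
  show ?thesis
  proof (cases "j < N'")
    case True
    define p where "p = real N - real j"
    have p: "p > 0" using True assms by (simp add: p_def)
    have "(\<Sum>i=Suc j..N-1. hybrid N N' i j * Q_value_tail N N' m (Suc i)) =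
      (\<Sum>i=Suc j..N-1. - 1 / (p * (p + 1)) *
        ((if i < N' then real N - real i else (real N - real N' + 1) / 2) *
          Q_value_tail N N' m (Suc i)))"
      using True assms by (intro sum.cong) (auto simp: hybrid_def p_def)
    also have "\<dots> = - 1 / (p * (p + 1)) * real (Suc (N - Suc j) choose Suc (Suc m))"
      unfolding sum_distrib_left[symmetric]
      using True assms by (subst sum_Q_value_tail_low_weighted) auto
    also have "Suc (N - Suc j) = N - j" using assms True by simp
    finally have rest: "(\<Sum>i=Suc j..N-1. hybrid N N' i j * Q_value_tail N N' m (Suc i)) =
      - 1 / (p * (p + 1)) * real (N - j choose Suc (Suc m))" .
    define r where "r = N - Suc j"
    have r: "N - j = Suc r" "N - j - 1 = r" "N - Suc j = r"
      using assms True by (auto simp: r_def)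
    have p_eq: "p = real r + 1" using r assms by (simp add: p_def flip: of_nat_diff)
    \<comment> \<open>All binomials are expressed through \<open>a\<close>, which reduces the claim
      to an identity of rational functions in \<open>r\<close> and \<open>m\<close>.\<close>
    define a where "a = real (r choose m)"
    have "real (Suc m) * real (Suc r choose Suc m) = real (Suc r) * a"
      using Suc_times_binomial[of m r] unfolding a_def by (metis of_nat_mult)
    then have b: "real (Suc r choose Suc m) = (real r + 1) * a / (real m + 1)"
      by (simp add: field_simps)
    have "real (Suc (Suc m)) * real (Suc r choose Suc (Suc m)) =
        (real r - real m) * real (Suc r choose Suc m)"
    proof (cases "m \<le> r")
      case True
      have "Suc (Suc m) * (Suc r choose Suc (Suc m)) = (r - m) * (Suc r choose Suc m)"
        using binomial_absorb_comp[of "Suc r" "Suc m"] Suc_times_binomial[of "Suc m" r] by simp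
      then show ?thesis using True by (metis of_nat_mult of_nat_diff)
    qed (simp add: binomial_eq_0 del: binomial_Suc_Suc)
    then have "real (Suc r choose Suc (Suc m)) * (real m + 2) =
        (real r - real m) * real (Suc r choose Suc m)"
      by (simp add: algebra_simps del: binomial_Suc_Suc)
    then have "real (Suc r choose Suc (Suc m)) =
        (real r - real m) * real (Suc r choose Suc m) / (real m + 2)"
      by (subst eq_divide_eq) (simp del: binomial_Suc_Suc)
    then have c: "real (Suc r choose Suc (Suc m)) =
        (real r - real m) / (real m + 2) * ((real r + 1) * a / (real m + 1))"
      unfolding b by (simp del: binomial_Suc_Suc)
    have "hybrid N N' j j * Q_value_tail N N' m (Suc j) = p / (p + 1) * (a / (real m + 1))"
      using True assms by (simp add: hybrid_def Q_value_tail_low r p_def a_def)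
    then have "(\<Sum>i=j..N-1. hybrid N N' i j * Q_value_tail N N' m (Suc i)) =
      p / (p + 1) * (a / (real m + 1)) - 1 / (p * (p + 1)) *
        ((real r - real m) / (real m + 2) * ((real r + 1) * a / (real m + 1)))"
      unfolding split rest r c by simp
    also have "\<dots> = a / (real m + 2)"
      unfolding p_eq by (simp add: divide_simps) (simp add: algebra_simps)
    finally show ?thesis using True by (simp add: Q_value_def r a_def add.commute)
  next
    case False
    define p where "p = real j - real N' + 1"
    define K where "K = real N - real N' + 1"
    have pos: "p > 0" "K > 0" using False assms by (auto simp: p_def K_def)
    have "(\<Sum>i=Suc j..N-1. hybrid N N' i j * Q_value_tail N N' m (Suc i)) =
      (\<Sum>i=Suc j..N-1. - p * (Q_value_tail N N' m (Suc i) /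
        ((real i - real N' + 1) * (real i - real N' + 2))))"
      using False assms by (intro sum.cong) (auto simp: hybrid_def p_def)
    also have "\<dots> = - p * (real (N - j - 1 choose Suc m) / (K * (p + 1)))"
      unfolding sum_distrib_left[symmetric]
      using False assms by (subst sum_Q_value_tail_high_weighted) (auto simp: p_def K_def algebra_simps)
    finally have rest: "(\<Sum>i=Suc j..N-1. hybrid N N' i j * Q_value_tail N N' m (Suc i)) =
      - p * (real (N - j - 1 choose Suc m) / (K * (p + 1)))" .
    have "real (Suc j) - real N' + 1 = p + 1" "real j - real N' + 2 = p + 1"
      by (auto simp: p_def)
    then have "hybrid N N' j j * Q_value_tail N N' m (Suc j) =
      p / (p + 1) * (((p + 1) * real (N - j - 1 choose m) + real (N - j - 1 choose Suc m)) / K)"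
      using False assms
      by (simp only: hybrid_def Q_value_tail_def p_def[symmetric] K_def[symmetric]) simp
    then have "(\<Sum>i=j..N-1. hybrid N N' i j * Q_value_tail N N' m (Suc i)) =
      p / (p + 1) * (((p + 1) * real (N - j - 1 choose m) + real (N - j - 1 choose Suc m)) / K)
        - p * (real (N - j - 1 choose Suc m) / (K * (p + 1)))"
      unfolding split rest by simp
    also have "\<dots> = p / K * real (N - j - 1 choose m)"
      using pos by (simp add: divide_simps) (simp add: algebra_simps)
    finally show ?thesis using False by (simp add: Q_value_def p_def K_def)
  qed
qed

lemma Q_hybrid:
  assumes "1 \<le> N'" "N' < N" "1 \<le> j" "j \<le> N - 1"
  shows "Q (hybrid N N') (N - 1) (Suc m) j = Q_value N N' (Suc m) j"
  using assms(3,4)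
proof (induction m arbitrary: j)
  case 0
  have "Q_tail (hybrid N N') (N - 1) 0 (Suc i) = Q_value_tail N N' 0 (Suc i)" if "i \<in> {j..N-1}" for i
    using that assms by (subst Q_value_tail_0) (auto simp: Q_tail_def)
  then show ?case
    unfolding Q_Suc[OF 0(1)] using hybrid_column[OF 0 assms(1,2), of 0] by simp
next
  case (Suc m)
  have "Q_tail (hybrid N N') (N - 1) (Suc m) (Suc i) = Q_value_tail N N' (Suc m) (Suc i)"
    if "i \<in> {j..N-1}" for i
  proof -
    have "(\<Sum>b=Suc i..N-1. Q (hybrid N N') (N - 1) (Suc m) b) =
        (\<Sum>b=Suc i..N-1. Q_value N N' (Suc m) b)"
      by (intro sum.cong refl Suc.IH) auto
    also have "\<dots> = Q_value_tail N N' (Suc m) (Suc i)"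
      using that assms by (intro sum_Q_value) auto
    finally show ?thesis by (simp add: Q_tail_def)
  qed
  then show ?case
    unfolding Q_Suc[OF Suc.prems(1)] using hybrid_column[OF Suc.prems assms(1,2), of "Suc m"] by simp
qed

section \<open>The minimax bound\<close>

text \<open>The slack in the cocoercivity inequality of \<open>I - T\<close>, with \<open>g\<close>
  the residuals at the points \<open>x\<close>. The index type is free, so that points other than
  iterates can be paired as well.\<close>

definition coco_gap :: "('i \<Rightarrow> 'a::real_inner) \<Rightarrow> ('i \<Rightarrow> 'a) \<Rightarrow> 'i \<Rightarrow> 'i \<Rightarrow> real" where
  "coco_gap x g k j = inner (g k - g j) (x k - x j) - (norm (g k - g j))\<^sup>2 / 2"

text \<open>With \<open>d\<close> and \<open>e\<close> the differences of points and of images, the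
  gap equals \<open>(inner d d - inner e e) / 2\<close>.\<close>

lemma coco_gap_nonneg:
  fixes T :: "'a::real_inner \<Rightarrow> 'a"
  assumes "1-lipschitz_on UNIV T"
  shows "coco_gap x (\<lambda>i. x i - T (x i)) k j \<ge> 0"
proof -
  define d e where "d = x k - x j" and "e = T (x k) - T (x j)"
  have "norm e \<le> norm d"
    using lipschitz_onD[OF assms, of "x k" "x j"] by (simp add: d_def e_def dist_norm)
  then have "inner e e \<le> inner d d"
    by (simp add: norm_le)
  moreover have "coco_gap x (\<lambda>i. x i - T (x i)) k j = inner (d - e) d - (norm (d - e))\<^sup>2 / 2"
    unfolding coco_gap_def by (simp add: d_def e_def algebra_simps)
  ultimately show ?thesis
    by (simp add: power2_norm_eq_inner inner_diff_left inner_diff_right inner_commute field_simps)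
qed

section \<open>Telescoping sums of cocoercivity inequalities\<close>

text \<open>The Halpern potential argument with a constant drift \<open>a *\<^sub>R S\<close>. The
  weight \<open>p i * (p i + 1)\<close> clears the denominators of the step; the squared norms of
  earlier residuals then cancel, leaving terms in \<open>g M\<close>, \<open>G M\<close> and
  \<open>S\<close> alone.\<close>

lemma high_steps_telescope:
  fixes x g :: "nat \<Rightarrow> 'a::real_inner" and S :: 'a and a :: real and N N' :: nat
  defines "p \<equiv> \<lambda>i. real i - real N' + 1"
  defines "G \<equiv> \<lambda>i. \<Sum>j=N'..<i. p j *\<^sub>R g j"
  assumes step: "\<And>i. N' \<le> i \<Longrightarrow> i < N \<Longrightarrow>
      x i - x (Suc i) = (p i / (p i + 1)) *\<^sub>R g i - (1 / (p i * (p i + 1))) *\<^sub>R G i - a *\<^sub>R S"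
    and M: "N' \<le> M" "M \<le> N"
  shows "x N' - x M = (1 / p M) *\<^sub>R G M - ((p M - 1) * a) *\<^sub>R S"
    and "(\<Sum>i=N'..<M. p i * (p i + 1) * coco_gap x g (Suc i) i) =
      inner (g M) (G M) - p M * (p M - 1) / 2 * (norm (g M))\<^sup>2
        + a * inner ((p M * (p M - 1)) *\<^sub>R g M - 2 *\<^sub>R G M) S"
  using M(1)
proof (induction M rule: dec_induct)
  case base
  { case 1 then show ?case by (simp add: p_def G_def) }
  { case 2 then show ?case by (simp add: p_def G_def) }
next
  case (step i)
  have i: "N' \<le> i" "i < N" and p_pos: "p i > 0" using step.hyps M by (auto simp: p_def)
  have p_Suc: "p (Suc i) = p i + 1" by (simp add: p_def)
  have G_Suc: "G (Suc i) = G i + p i *\<^sub>R g i" using i by (simp add: G_def)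
  note d = assms(3)[OF i]
  { case 1
    have "x N' - x (Suc i) = (x N' - x i) + (x i - x (Suc i))" by simp
    also have "\<dots> = (1 / p i - 1 / (p i * (p i + 1))) *\<^sub>R G i + (p i / (p i + 1)) *\<^sub>R g i
        - ((p i - 1) * a + a) *\<^sub>R S"
      unfolding d using step.IH(1) i by (simp add: algebra_simps)
    also have "1 / p i - 1 / (p i * (p i + 1)) = 1 / (p i + 1)"
      using p_pos by (simp add: divide_simps)
    also have "(p i - 1) * a + a = (p (Suc i) - 1) * a" by (simp add: p_Suc algebra_simps)
    finally show ?case unfolding p_Suc G_Suc by (simp add: scaleR_add_right) }
  { case 2
    have "x (Suc i) - x i = - (x i - x (Suc i))" by simp
    also have "\<dots> = (1 / (p i * (p i + 1))) *\<^sub>R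
        (G i - (p i)\<^sup>2 *\<^sub>R g i + (p i * (p i + 1) * a) *\<^sub>R S)"
      unfolding d using p_pos by (simp add: scaleR_add_right scaleR_diff_right power2_eq_square)
    finally have dx: "p i * (p i + 1) * inner v (x (Suc i) - x i) =
        inner v (G i - (p i)\<^sup>2 *\<^sub>R g i + (p i * (p i + 1) * a) *\<^sub>R S)" for v
      using p_pos by simp
    have "p i * (p i + 1) * coco_gap x g (Suc i) i =
        inner (g (Suc i) - g i) (G i - (p i)\<^sup>2 *\<^sub>R g i + (p i * (p i + 1) * a) *\<^sub>R S)
        - p i * (p i + 1) * (norm (g (Suc i) - g i))\<^sup>2 / 2"
      unfolding coco_gap_def dx[symmetric] by (simp add: algebra_simps)
    then have "(\<Sum>j=N'..<Suc i. p j * (p j + 1) * coco_gap x g (Suc j) j) =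
        (inner (g i) (G i) - p i * (p i - 1) / 2 * (norm (g i))\<^sup>2
          + a * inner ((p i * (p i - 1)) *\<^sub>R g i - 2 *\<^sub>R G i) S) +
        (inner (g (Suc i) - g i) (G i - (p i)\<^sup>2 *\<^sub>R g i + (p i * (p i + 1) * a) *\<^sub>R S)
        - p i * (p i + 1) * (norm (g (Suc i) - g i))\<^sup>2 / 2)"
      using step.IH(2) i by simp
    then show ?case
      unfolding p_Suc G_Suc power2_norm_eq_inner inner_add_right inner_add_left inner_diff_right
        inner_diff_left inner_scaleR_right inner_scaleR_left
      by (simp add: inner_commute power2_eq_square field_simps) }
qed

lemma low_steps_sum:
  fixes g :: "nat \<Rightarrow> 'a::real_inner"
  assumes step: "\<And>i. 1 \<le> i \<Longrightarrow> i < N' \<Longrightarrow> x i - x (Suc i) =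
      ((real N - real i) / (real N - real i + 1)) *\<^sub>R g i -
      (real N - real i) *\<^sub>R (\<Sum>j=1..<i. (1 / ((real N - real j) * (real N - real j + 1))) *\<^sub>R g j)"
    and M: "1 \<le> M" "M \<le> N'" "N' < N"
  shows "x 1 - x M = ((real N - real M) * (real N - real M + 1) / 2) *\<^sub>R
      (\<Sum>j=1..<M. (1 / ((real N - real j) * (real N - real j + 1))) *\<^sub>R g j) +
      (1 / 2) *\<^sub>R (\<Sum>j=1..<M. g j)"
  using M(1)
proof (induction M rule: dec_induct)
  case (step i)
  define t where "t = real N - real i"
  define S where "S = (\<Sum>j=1..<i. (1 / ((real N - real j) * (real N - real j + 1))) *\<^sub>R g j)"
  have t: "t > 0" using step.hyps M by (simp add: t_def)
  have S_Suc: "(\<Sum>j=1..<Suc i. (1 / ((real N - real j) * (real N - real j + 1))) *\<^sub>R g j) =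
      S + (1 / (t * (t + 1))) *\<^sub>R g i"
    using step by (simp add: S_def t_def)
  have x_i: "x 1 - x i = (t * (t + 1) / 2) *\<^sub>R S + (1 / 2) *\<^sub>R (\<Sum>j=1..<i. g j)"
    unfolding S_def t_def by (rule step.IH)
  have d: "x i - x (Suc i) = (t / (t + 1)) *\<^sub>R g i - t *\<^sub>R S"
    unfolding S_def t_def using step.hyps M by (intro assms(1)) auto
  have "x 1 - x (Suc i) = (x 1 - x i) + (x i - x (Suc i))" by simp
  also have "\<dots> = (t * (t + 1) / 2 - t) *\<^sub>R S + (t / (t + 1)) *\<^sub>R g i + (1 / 2) *\<^sub>R (\<Sum>j=1..<i. g j)"
    unfolding x_i d by (simp add: scaleR_diff_left)
  \<comment> \<open>Both coefficients are rewritten for \<open>t - 1\<close>, the value of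
    \<open>t\<close> at the next index; the share \<open>1 / 2\<close> of \<open>g i\<close> joins
    the plain sum.\<close>
  also have "t * (t + 1) / 2 - t = (t - 1) * t / 2" by (simp add: field_simps)
  also have "t / (t + 1) = (t - 1) * t / 2 * (1 / (t * (t + 1))) + 1 / 2"
    using t by (simp add: divide_simps)
  finally have "x 1 - x (Suc i) = ((t - 1) * t / 2) *\<^sub>R (S + (1 / (t * (t + 1))) *\<^sub>R g i) +
      (1 / 2) *\<^sub>R ((\<Sum>j=1..<i. g j) + g i)"
    by (simp only: scaleR_add_left scaleR_add_right scaleR_scaleR) (simp add: algebra_simps)
  moreover have "real N - real (Suc i) = t - 1" by (simp add: t_def)
  ultimately show ?case
    unfolding S_Suc using step by simp
qed simp

text \<open>Since \<open>b j = 1 / K (j + 1) - 1 / K j\<close>, the weights telescope, and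
  \<open>b j\<close> times the coefficient of \<open>S j\<close> is \<open>1 / 2\<close>. The terms
  free of \<open>g N\<close> and \<open>\<delta>\<close> thus form the increment of
  \<open>- inner (S i) (E i) / 2\<close>. The vector \<open>\<delta>\<close> stands for the
  displacement \<open>x N - x 1\<close>.\<close>

lemma low_gaps_sum:
  fixes x g :: "nat \<Rightarrow> 'a::real_inner" and N :: nat
  defines "b \<equiv> \<lambda>j. 1 / ((real N - real j) * (real N - real j + 1))"
  defines "S \<equiv> \<lambda>i. \<Sum>j=1..<i. b j *\<^sub>R g j"
  defines "E \<equiv> \<lambda>i. \<Sum>j=1..<i. g j"
  defines "K \<equiv> \<lambda>i. real N - real i + 1"
  assumes x: "\<And>j. 1 \<le> j \<Longrightarrow> j < M \<Longrightarrow>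
      x N - x j = \<delta> + ((real N - real j) * (real N - real j + 1) / 2) *\<^sub>R S j + (1 / 2) *\<^sub>R E j"
    and M: "1 \<le> M" "M \<le> N"
  shows "(\<Sum>j=1..<M. b j * coco_gap x g N j) =
    (1 / K M - 1 / real N) * inner (g N) \<delta> - inner (S M) \<delta>
    + (inner (g N) (E M) / (2 * K M) - (K M - 1) / 2 * inner (g N) (S M))
    - inner (S M) (E M) / 2 - (1 / K M - 1 / real N) / 2 * (norm (g N))\<^sup>2"
  using M(1)
proof (induction M rule: dec_induct)
  case base
  then show ?case by (simp add: S_def E_def K_def)
next
  case (step i)
  define t where "t = real N - real i"
  have t: "t > 0" using step.hyps M by (simp add: t_def)
  have K: "K i = t + 1" "K (Suc i) = t" by (simp_all add: K_def t_def)
  have b_t: "b i = 1 / (t * (t + 1))" by (simp add: b_def t_def)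
  have b: "b i * (t * (t + 1) / 2) = 1 / 2" using t by (simp add: b_t)
  have S_Suc: "S (Suc i) = S i + b i *\<^sub>R g i" and E_Suc: "E (Suc i) = E i + g i"
    using step by (simp_all add: S_def E_def)
  have "x N - x i = \<delta> + (t * (t + 1) / 2) *\<^sub>R S i + (1 / 2) *\<^sub>R E i"
    using x[of i] step.hyps by (simp add: t_def)
  then have "b i * coco_gap x g N i = b i * inner (g N - g i) \<delta>
      + b i * (t * (t + 1) / 2) * inner (g N - g i) (S i) + b i / 2 * inner (g N - g i) (E i)
      - b i / 2 * (norm (g N - g i))\<^sup>2"
    unfolding coco_gap_def
    by (simp only: inner_add_right inner_scaleR_right) (simp add: distrib_left right_diff_distrib)
  then have gap: "b i * coco_gap x g N i = b i * inner (g N - g i) \<delta>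
      + inner (g N - g i) (S i) / 2 + b i / 2 * inner (g N - g i) (E i)
      - b i / 2 * (norm (g N - g i))\<^sup>2"
    unfolding b by simp
  \<comment> \<open>These express the change of the \<open>K\<close>-dependent coefficients from
    index \<open>i\<close> to \<open>Suc i\<close> through \<open>b i\<close>, so that the remaining
    comparison is linear.\<close>
  have tb: "inner (g N) (E i) / (2 * (t + 1)) = inner (g N) (E i) / (2 * t) - b i / 2 * inner (g N) (E i)"
    "inner (g N) (g i) / (2 * t) = (t - 1) / 2 * (b i * inner (g N) (g i)) + b i * inner (g N) (g i)"
    "1 / (t + 1) = 1 / t - b i"
    using t by (simp_all add: b_t divide_simps) (simp_all add: algebra_simps)
  have "(\<Sum>j=1..<Suc i. b j * coco_gap x g N j) =
      (\<Sum>j=1..<i. b j * coco_gap x g N j) + b i * coco_gap x g N i"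
    using step by simp
  also have "(\<Sum>j=1..<i. b j * coco_gap x g N j) =
    (1 / K i - 1 / real N) * inner (g N) \<delta> - inner (S i) \<delta>
    + (inner (g N) (E i) / (2 * K i) - (K i - 1) / 2 * inner (g N) (S i))
    - inner (S i) (E i) / 2 - (1 / K i - 1 / real N) / 2 * (norm (g N))\<^sup>2"
    using step by simp
  finally show ?case
    unfolding gap K S_Suc E_Suc inner_add_right inner_add_left inner_scaleR_right inner_scaleR_left
      inner_diff_left inner_diff_right power2_norm_eq_inner tb(1) tb(3) add_divide_distrib tb(2)
    by (simp add: algebra_simps inner_commute add_divide_distrib diff_divide_distrib)
qed

lemma hybrid_last_residual_bound:
  fixes x g :: "nat \<Rightarrow> 'a::real_inner" and N N' :: nat
  assumes N': "1 \<le> N'" "N' < N"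
    and step: "\<And>i. 1 \<le> i \<Longrightarrow> i < N \<Longrightarrow> x i - x (Suc i) = (\<Sum>j=1..i. hybrid N N' i j *\<^sub>R g j)"
    and gap: "\<And>k j. coco_gap x g k j \<ge> 0"
  shows "(real N - 1) / 2 * (norm (g N))\<^sup>2 \<le> inner (g N) (x 1 - x N)"
proof -
  define K where "K = real N - real N' + 1"
  define b where "b j = 1 / ((real N - real j) * (real N - real j + 1))" for j
  define p where "p j = real j - real N' + 1" for j
  define S where "S = (\<Sum>j=1..<N'. b j *\<^sub>R g j)"
  define E where "E = (\<Sum>j=1..<N'. g j)"
  define G where "G = (\<Sum>j=N'..<N. p j *\<^sub>R g j)"
  have K: "K > 0" using N' by (simp add: K_def)
  have p_N: "p N = K" by (simp add: p_def K_def)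
  have low: "x i - x (Suc i) = ((real N - real i) / (real N - real i + 1)) *\<^sub>R g i -
      (real N - real i) *\<^sub>R (\<Sum>j=1..<i. b j *\<^sub>R g j)" if "1 \<le> i" "i < N'" for i
  proof -
    have "x i - x (Suc i) = (\<Sum>j=1..i. hybrid N N' i j *\<^sub>R g j)"
      using that N' by (intro step) auto
    also have "{1..i} = insert i {1..<i}" using that by auto
    also have "(\<Sum>j\<in>insert i {1..<i}. hybrid N N' i j *\<^sub>R g j) = hybrid N N' i i *\<^sub>R g i +
        (\<Sum>j=1..<i. hybrid N N' i j *\<^sub>R g j)"
      by simp
    also have "hybrid N N' i i = (real N - real i) / (real N - real i + 1)"
      using that N' by (simp add: hybrid_def)
    also have "(\<Sum>j=1..<i. hybrid N N' i j *\<^sub>R g j) =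
        - ((real N - real i) *\<^sub>R (\<Sum>j=1..<i. b j *\<^sub>R g j))"
      unfolding scaleR_sum_right sum_negf[symmetric]
      using that N' by (intro sum.cong)
        (auto simp: hybrid_def b_def minus_divide_left simp flip: scaleR_minus_left)
    finally show ?thesis by simp
  qed
  have high: "x i - x (Suc i) = (p i / (p i + 1)) *\<^sub>R g i -
      (1 / (p i * (p i + 1))) *\<^sub>R (\<Sum>j=N'..<i. p j *\<^sub>R g j) - (K / 2) *\<^sub>R S"
    if "N' \<le> i" "i < N" for i
  proof -
    have "x i - x (Suc i) = (\<Sum>j=1..i. hybrid N N' i j *\<^sub>R g j)"
      using that N' by (intro step) auto
    also have "{1..i} = insert i ({1..<N'} \<union> {N'..<i})" using that N' by auto
    also have "(\<Sum>j\<in>insert i ({1..<N'} \<union> {N'..<i}). hybrid N N' i j *\<^sub>R g j) =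
        hybrid N N' i i *\<^sub>R g i + ((\<Sum>j=1..<N'. hybrid N N' i j *\<^sub>R g j) +
        (\<Sum>j=N'..<i. hybrid N N' i j *\<^sub>R g j))"
      using that by (subst sum.insert) (auto intro!: sum.union_disjoint)
    also have "hybrid N N' i i = p i / (p i + 1)"
      using that N' by (simp add: hybrid_def p_def algebra_simps)
    also have "(\<Sum>j=1..<N'. hybrid N N' i j *\<^sub>R g j) = - ((K / 2) *\<^sub>R S)"
      unfolding S_def scaleR_sum_right sum_negf[symmetric]
      using that N' by (intro sum.cong) (auto simp: hybrid_def b_def K_def)
    also have "(\<Sum>j=N'..<i. hybrid N N' i j *\<^sub>R g j) =
        - ((1 / (p i * (p i + 1))) *\<^sub>R (\<Sum>j=N'..<i. p j *\<^sub>R g j))"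
      unfolding scaleR_sum_right sum_negf[symmetric]
    proof (intro sum.cong refl)
      fix j assume j: "j \<in> {N'..<i}"
      have "real i - real N' + 2 = p i + 1" by (simp add: p_def)
      then have "hybrid N N' i j = - p j / (p i * (p i + 1))"
        using j that N' by (simp only: hybrid_def p_def[symmetric]) simp
      then show "hybrid N N' i j *\<^sub>R g j = - ((1 / (p i * (p i + 1))) *\<^sub>R p j *\<^sub>R g j)" by simp
    qed
    finally show ?thesis by simp
  qed
  have x_low: "x 1 - x j = ((real N - real j) * (real N - real j + 1) / 2) *\<^sub>R
      (\<Sum>i=1..<j. b i *\<^sub>R g i) + (1 / 2) *\<^sub>R (\<Sum>i=1..<j. g i)" if "1 \<le> j" "j \<le> N'" for j
    using low_steps_sum[of N' x N g j] low that N' by (simp add: b_def)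
  have x_high: "x N' - x N = (1 / K) *\<^sub>R G - ((K - 1) * (K / 2)) *\<^sub>R S"
    using high_steps_telescope(1)[of N' N x g "K / 2" S N] high N'
    by (simp add: p_def K_def G_def)
  have "x 1 - x N = (x 1 - x N') + (x N' - x N)" by simp
  \<comment> \<open>\<open>S\<close> enters the two blocks with coefficients
    \<open>K * (K - 1) / 2\<close> of opposite sign and cancels.\<close>
  also have "\<dots> = (1 / 2) *\<^sub>R E + (1 / K) *\<^sub>R G"
  proof -
    have "(real N - real N') * (real N - real N' + 1) / 2 = (K - 1) * (K / 2)"
      by (simp add: K_def)
    moreover have "x 1 - x N' =
        ((real N - real N') * (real N - real N' + 1) / 2) *\<^sub>R S + (1 / 2) *\<^sub>R E"
      unfolding S_def E_def using N' by (intro x_low) auto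
    ultimately show ?thesis unfolding x_high by simp
  qed
  finally have x_total: "x N - x 1 = - ((1 / 2) *\<^sub>R E + (1 / K) *\<^sub>R G)"
    by (metis minus_diff_eq)
  have low_sum: "(\<Sum>j=1..<N'. b j * coco_gap x g N j) =
    (1 / K - 1 / real N) * inner (g N) (x N - x 1) - inner S (x N - x 1)
    + (inner (g N) E / (2 * K) - (K - 1) / 2 * inner (g N) S)
    - inner S E / 2 - (1 / K - 1 / real N) / 2 * (norm (g N))\<^sup>2"
  proof -
    have x_j: "x N - x j = (x N - x 1) + ((real N - real j) * (real N - real j + 1) / 2) *\<^sub>R
        (\<Sum>i=1..<j. b i *\<^sub>R g i) + (1 / 2) *\<^sub>R (\<Sum>i=1..<j. g i)" if "1 \<le> j" "j < N'" for j
    proof -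
      have "x N - x j = (x N - x 1) + (x 1 - x j)" by simp
      also note x_low[of j]
      finally show ?thesis using that by (simp add: add.assoc)
    qed
    show ?thesis
      unfolding b_def S_def E_def K_def
    proof (rule low_gaps_sum, goal_cases)
      case (1 j)
      then show ?case by (rule x_j[unfolded b_def])
    qed (use N' in simp_all)
  qed
  have high_sum: "(\<Sum>i=N'..<N. p i * (p i + 1) * coco_gap x g (Suc i) i) =
      inner (g N) G - K * (K - 1) / 2 * (norm (g N))\<^sup>2
        + K / 2 * inner ((K * (K - 1)) *\<^sub>R g N - 2 *\<^sub>R G) S"
    using high_steps_telescope(2)[of N' N x g "K / 2" S N] high N'
    by (simp add: p_def K_def G_def)
  \<comment> \<open>The weights \<open>N * b j\<close> and
    \<open>N * p i * (p i + 1) / K\<^sup>2\<close> are the values of the positive certificates for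
    the prescribed Q-functions.\<close>
  have "0 \<le> real N * (\<Sum>j=1..<N'. b j * coco_gap x g N j) +
      real N / K\<^sup>2 * (\<Sum>i=N'..<N. p i * (p i + 1) * coco_gap x g (Suc i) i)"
    using N' by (intro add_nonneg_nonneg mult_nonneg_nonneg sum_nonneg gap)
      (auto simp: b_def p_def)
  also have "\<dots> = - inner (g N) (x N - x 1) - (real N - 1) / 2 * (norm (g N))\<^sup>2"
  proof -
    \<comment> \<open>The variables stand for the inner products that occur. The terms in
      \<open>s\<close> and \<open>w\<close> cancel between the two blocks, those in \<open>r\<close>
      within the first.\<close>
    have collect: "n * ((1 / K - 1 / n) * - (e / 2 + q / K) + (r / 2 + w / K) +
          (e / (2 * K) - (K - 1) / 2 * s) - r / 2 - (1 / K - 1 / n) / 2 * c) +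
        n / K\<^sup>2 * (q - K * (K - 1) / 2 * c + K / 2 * (K * (K - 1) * s - 2 * w)) =
        e / 2 + q / K - (n - 1) / 2 * c" if "n > 0" for n e q r w s c :: real
      using that K by (simp add: field_simps power2_eq_square)
    have "inner S (x N - x 1) = - (inner S E / 2 + inner G S / K)"
      "inner (g N) (x N - x 1) = - (inner (g N) E / 2 + inner (g N) G / K)"
      unfolding x_total
      by (simp_all add: inner_diff_right inner_commute[of E] inner_commute[of G])
    moreover have "inner ((K * (K - 1)) *\<^sub>R g N - 2 *\<^sub>R G) S =
        K * (K - 1) * inner (g N) S - 2 * inner G S"
      by (simp only: inner_diff_left inner_scaleR_left)
    ultimately show ?thesis
      unfolding low_sum high_sum
      using collect[of "real N" "inner (g N) E" "inner (g N) G" "inner S E" "inner G S"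
          "inner (g N) S" "(norm (g N))\<^sup>2"] N'
      by simp
  qed
  also have "- inner (g N) (x N - x 1) = inner (g N) (x 1 - x N)"
    by (simp add: inner_diff_right)
  finally show ?thesis by simp
qed

section \<open>From the residual inequality to the minimax rate\<close>

lemma minimax_optimal_hybrid:
  assumes "1 \<le> N'" "N' < N"
  shows "minimax_optimal TYPE('n::finite) N (hybrid N N')"
  unfolding minimax_optimal_def
proof (intro allI impI, elim conjE)
  fix T :: "real ^ 'n \<Rightarrow> real ^ 'n" and ystar and y :: "nat \<Rightarrow> real ^ 'n"
  assume T: "1-lipschitz_on UNIV T" and fixed: "T ystar = ystar"
    and iter: "\<forall>k<N - 1. y (k + 1) = y k -
      (\<Sum>j=0..k. hybrid N N' (k + 1) (j + 1) *\<^sub>R (y j - T (y j)))"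
  \<comment> \<open>The shift matches the 1-based matrix indices: \<open>x 1 = y 0\<close> and
    \<open>x N = y (N - 1)\<close>.\<close>
  define x where "x i = y (i - 1)" for i
  define g where "g i = x i - T (x i)" for i
  have "x i - x (Suc i) = (\<Sum>j=1..i. hybrid N N' i j *\<^sub>R g j)" if "1 \<le> i" "i < N" for i
  proof -
    obtain k where k: "i = Suc k" using \<open>1 \<le> i\<close> by (cases i) auto
    have "x i - x (Suc i) = y k - y (k + 1)" by (simp add: x_def k)
    also have "\<dots> = (\<Sum>j=0..k. hybrid N N' (k + 1) (j + 1) *\<^sub>R (y j - T (y j)))"
      using iter that k by simp
    also have "\<dots> = (\<Sum>j=Suc 0..Suc k. hybrid N N' i j *\<^sub>R g j)"
      by (subst sum.shift_bounds_cl_Suc_ivl) (simp add: k x_def g_def)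
    finally show ?thesis by (simp add: k)
  qed
  moreover have "coco_gap x g k j \<ge> 0" for k j
    using coco_gap_nonneg[OF T, of x k j] by (simp add: g_def[abs_def])
  ultimately have "(real N - 1) / 2 * (norm (g N))\<^sup>2 \<le> inner (g N) (x 1 - x N)"
    using assms by (intro hybrid_last_residual_bound)
  \<comment> \<open>The residual at the fixed point is zero; indexing by \<open>bool\<close> pairs
    \<open>x N\<close> with \<open>ystar\<close> in one cocoercivity inequality. It supplies the
    missing half of \<open>(norm (g N))\<^sup>2\<close>.\<close>
  moreover have "(norm (g N))\<^sup>2 / 2 \<le> inner (g N) (x N - ystar)"
    using coco_gap_nonneg[OF T, of "case_bool (x N) ystar" True False]
    by (simp add: coco_gap_def fixed g_def)
  ultimately have "real N / 2 * (norm (g N))\<^sup>2 \<le> inner (g N) (x 1 - ystar)"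
    by (simp add: inner_diff_right field_simps)
  also have "\<dots> \<le> norm (g N) * norm (x 1 - ystar)" by (rule norm_cauchy_schwarz)
  finally have "norm (g N) * (real N * norm (g N)) \<le> norm (g N) * (2 * norm (x 1 - ystar))"
    by (simp add: power2_eq_square algebra_simps)
  then have "real N * norm (g N) \<le> 2 * norm (x 1 - ystar)"
    by (cases "g N = 0") auto
  then have "(real N * norm (g N))\<^sup>2 \<le> (2 * norm (x 1 - ystar))\<^sup>2"
    by (intro power_mono) auto
  then have "(norm (g N))\<^sup>2 \<le> 4 * (norm (x 1 - ystar))\<^sup>2 / (real N)\<^sup>2"
    using assms by (simp add: power_mult_distrib field_simps)
  then show "(norm (y (N - 1) - T (y (N - 1))))\<^sup>2 \<le> 4 * (norm (y 0 - ystar))\<^sup>2 / (real N)\<^sup>2"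
    by (simp add: g_def x_def)
qed

theorem proposition8:
  fixes N N' :: nat
  assumes "2 \<le> N'" and "N' + 2 \<le> N"
  shows "(\<forall>H\<in>lower_tri_nz (N - 1).
            ((\<forall>j\<in>{1..N'-1}. \<forall>k\<in>{j+1..N-1}. H_cert N H k j = 0) \<and>
             (\<forall>j\<in>{N'..N-1}. \<forall>k\<in>{j+2..N}. H_cert N H k j = 0) \<and>
             H_invariant N H)
            \<longleftrightarrow> (\<forall>j\<in>{1..N-1}. \<forall>k\<in>{1..N-j}. Q H (N - 1) k j = Q_value N N' k j))
       \<and> (\<exists>!H. H \<in> lower_tri_nz (N - 1) \<and>
            (\<forall>j\<in>{1..N-1}. \<forall>k\<in>{1..N-j}. Q H (N - 1) k j = Q_value N N' k j))
       \<and> (\<forall>H\<in>lower_tri_nz (N - 1).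
            (\<forall>j\<in>{1..N-1}. \<forall>k\<in>{1..N-j}. Q H (N - 1) k j = Q_value N N' k j) \<longrightarrow>
              (\<forall>j\<in>{1..N'-1}. H_cert N H N j > 0) \<and>
              (\<forall>j\<in>{N'..N-1}. H_cert N H (j + 1) j > 0) \<and>
              minimax_optimal TYPE('n::finite) N H)"
proof -
  let ?values = "\<lambda>H. \<forall>j\<in>{1..N-1}. \<forall>k\<in>{1..N-j}. Q H (N - 1) k j = Q_value N N' k j"
  have N': "1 \<le> N'" "N' < N" using assms by auto
  have "Q (hybrid N N') (N - 1) k j = Q_value N N' k j" if "j \<in> {1..N-1}" "k \<in> {1..N-j}" for j k
    using Q_hybrid[OF N', of j "k - 1"] that by simp
  then have values_hybrid: "?values (hybrid N N')" by blast
  \<comment> \<open>Injectivity of the Q-functions identifies any such \<open>H\<close> with the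
    explicit matrix, which gives uniqueness and transfers the minimax bound.\<close>
  have eq_hybrid: "H = hybrid N N'" if H: "H \<in> lower_tri_nz (N - 1)" "?values H" for H
  proof (rule lower_tri_nz_eqI[OF H(1) hybrid_in_lower_tri_nz])
    fix j k assume "1 \<le> j" "j \<le> N - 1" "1 \<le> k" "k + j \<le> Suc (N - 1)"
    then have "j \<in> {1..N-1}" "k \<in> {1..N-j}" by auto
    then show "Q H (N - 1) k j = Q (hybrid N N') (N - 1) k j"
      using H(2) values_hybrid by simp
  qed
  show ?thesis
  proof (intro conjI ballI impI)
    fix H assume "H \<in> lower_tri_nz (N - 1)"
    then show "((\<forall>j\<in>{1..N'-1}. \<forall>k\<in>{j+1..N-1}. H_cert N H k j = 0) \<and>
        (\<forall>j\<in>{N'..N-1}. \<forall>k\<in>{j+2..N}. H_cert N H k j = 0) \<and> H_invariant N H) \<longleftrightarrow> ?values H"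
      using N' by (intro certs_iff_Q_value) auto
  next
    show "\<exists>!H. H \<in> lower_tri_nz (N - 1) \<and> ?values H"
      using hybrid_in_lower_tri_nz values_hybrid eq_hybrid by blast
  next
    fix H j assume H: "?values H" and j: "j \<in> {1..N'-1}"
    show "H_cert N H N j > 0"
      by (rule H_cert_last_pos[where N' = N']) (use H j N' in auto)
  next
    fix H j assume H: "?values H" and j: "j \<in> {N'..N-1}"
    show "H_cert N H (j + 1) j > 0"
      by (rule H_cert_Suc_pos[where N' = N']) (use H j N' in auto)
  next
    fix H assume "H \<in> lower_tri_nz (N - 1)" "?values H"
    then show "minimax_optimal TYPE('n::finite) N H"
      using eq_hybrid minimax_optimal_hybrid[OF N'] by blast
  qed
qed

end
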